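(* Let $d \ge 1$, $b \ge 1$ and $0 \le a < 3d$ be integers, and let $m = 3db + a$, $s = 3db + a - d$. Then the optimal value of the fully-constrained muffin problem with $m$ muffins and $s$ students equals \[ \frac{db + X(a,d)}{3db + a - d}, \] where $X(a,d) = 0$ if $a = 0$; $X(a,d) = (a-d)/2$ if $0 < a \le d$, or if $d < a$ and $2d$ is divisible by $a - d$; and $X(a,d) = (a-d) f(a, a-d)$ otherwise.
   Context: The muffin problem with $m$ muffins and $s$ students asks to cut each of $m$ muffins of size $1$ into pieces of positive size and assign each piece to one of $s$ students so that every student receives total size $m/s$, maximizing the size of the smallest piece; $f(m,s)$ denotes its optimal value. The fully-constrained muffin problem additionally requires that each muffin be cut into exactly two pieces and that each student receive either $n$ or $n+1$ pieces, where $n = \lfloor 2m/s\rfloor$; its optimal value is the maximum smallest piece size over its feasible solutions. *)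

theory Defs
  imports Complex_Main
begin

text \<open>A procedure for the muffin problem with m muffins and s students is given by
  k pieces (indexed by p < k); piece p comes from muffin mu p (< m), is given to
  student st p (< s) and has size sz p > 0.  Every muffin is cut completely
  (its pieces sum to 1) and every student gets total m/s.\<close>
definition muffin_proc :: "nat \<Rightarrow> nat \<Rightarrow> nat \<Rightarrow> (nat \<Rightarrow> nat) \<Rightarrow> (nat \<Rightarrow> nat) \<Rightarrow> (nat \<Rightarrow> real) \<Rightarrow> bool" where
  "muffin_proc m s k mu st sz \<longleftrightarrow>
     (\<forall>p<k. mu p < m \<and> st p < s \<and> sz p > 0) \<and>
     (\<forall>i<m. (\<Sum>p\<in>{p. p < k \<and> mu p = i}. sz p) = 1) \<and>
     (\<forall>j<s. (\<Sum>p\<in>{p. p < k \<and> st p = j}. sz p) = real m / real s)"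

definition smallest_piece :: "nat \<Rightarrow> (nat \<Rightarrow> real) \<Rightarrow> real" where
  "smallest_piece k sz = Min (sz ` {..<k})"

definition muffin_f :: "nat \<Rightarrow> nat \<Rightarrow> real" where
  "muffin_f m s = Sup {smallest_piece k sz | k mu st sz. muffin_proc m s k mu st sz}"

definition fc_proc :: "nat \<Rightarrow> nat \<Rightarrow> nat \<Rightarrow> (nat \<Rightarrow> nat) \<Rightarrow> (nat \<Rightarrow> nat) \<Rightarrow> (nat \<Rightarrow> real) \<Rightarrow> bool" where
  "fc_proc m s k mu st sz \<longleftrightarrow>
     muffin_proc m s k mu st sz \<and>
     (\<forall>i<m. card {p. p < k \<and> mu p = i} = 2) \<and>
     (\<forall>j<s. card {p. p < k \<and> st p = j} \<in> {(2*m) div s, (2*m) div s + 1})"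

definition fc_optimal_value :: "nat \<Rightarrow> nat \<Rightarrow> real \<Rightarrow> bool" where
  "fc_optimal_value m s v \<longleftrightarrow>
     (\<exists>k mu st sz. fc_proc m s k mu st sz \<and> smallest_piece k sz = v) \<and>
     (\<forall>k mu st sz. fc_proc m s k mu st sz \<longrightarrow> smallest_piece k sz \<le> v)"

definition muffin_X :: "nat \<Rightarrow> nat \<Rightarrow> real" where
  "muffin_X a d =
    (if a = 0 then 0
     else if a \<le> d \<or> (d < a \<and> (a - d) dvd (2 * d)) then (real a - real d) / 2
     else (real a - real d) * muffin_f a (a - d))"

end

theory Submission
  imports Defs "HOL-Analysis.Analysis" "HOL-Library.Multiset"
begin

text \<open>
  Let s = m - d be the number of students. In a fully-constrained procedure 2 * d students
  get three pieces and the others two, except that for s = 2 * d everybody gets three. Muffins and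
  two-piece students form chains between three-piece students. Along a chain the size grows by d / s
  at every student, so only its end pieces matter. In the scaled sizes u = s * size - d * b, a
  chain through b - 1 + j two-piece students has end pieces summing to a - j * d, the three pieces
  of a student sum to a, and the j sum to a over the 3 * d chains.

  If a > 0, some j is positive, which gives the bound (a - d) / 2. For a > d a solution better than the
  claimed one has j = 0 or j = 1 everywhere, because f(a, a - d) is at least 1 / 3. A chain with
  j = 0 carries total a, just as a student does, so the two students it joins can be merged into
  one of total a. What is left are a muffins of size a - d shared by students of total a, that is,
  a scaled procedure for a muffins and a - d students. Conversely, an optimal procedure for
  (a, a - d) cuts every muffin in two and gives at least three pieces to every student, and these
  students can be split again into three-piece students.
\<close>

subsection \<open>Procedures that cut every muffin in two\<close>

lemma image_mset_mset_set_conv_sum: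
  "finite H \<Longrightarrow> image_mset f (mset_set H) = (\<Sum>p\<in>H. {#f p#})"
  by (induction H rule: finite_induct) auto

lemma image_mset_conv_sum_fibres:
  assumes "finite H" "finite S" "c ` H \<subseteq> S"
  shows "image_mset f (mset_set H) = (\<Sum>v\<in>S. image_mset f (mset_set {p\<in>H. c p = v}))"
  using sum.group[OF assms, of "\<lambda>p. {#f p#}"] assms(1)
  by (simp add: image_mset_mset_set_conv_sum)

text \<open>A submultiset of a multiset without repetitions has none either, so a decomposition of
  the image lifts to a subset of \<open>H\<close> and its complement.\<close>

lemma image_mset_mset_set_split:
  assumes "finite H" "image_mset f (mset_set H) = A + B"
  obtains K where "K \<subseteq> H" "image_mset f (mset_set K) = A" "image_mset f (mset_set (H - K)) = B"
proof -
  obtain P Q where PQ: "mset_set H = P + Q" "A = image_mset f P" "B = image_mset f Q"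
    using image_mset_eq_plusD[OF assms(2)] by blast
  have "P \<subseteq># mset_set H" using PQ by simp
  then have le: "count P x \<le> count (mset_set H) x" for x
    by (rule mset_subset_eq_count)
  have sub: "set_mset P \<subseteq> H"
    using assms(1) set_mset_union[of P Q] unfolding PQ(1)[symmetric] by auto
  have "count P x = count (mset_set (set_mset P)) x" for x
  proof (cases "x \<in># P")
    case True
    then have "count P x \<le> 1" using le[of x] sub assms(1) by auto
    moreover have "count P x > 0" using True by (rule count_greater_zero_iff[THEN iffD2])
    ultimately have "count P x = 1" by linarith
    then show ?thesis using True by simp
  qed (simp add: not_in_iff)
  then have P: "P = mset_set (set_mset P)" by (rule multiset_eqI)
  have "Q = mset_set H - P" using PQ by simp
  also have "\<dots> = mset_set (H - set_mset P)"
    using mset_set_Diff[OF assms(1) sub] P by simp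
  finally show thesis using that[of "set_mset P"] P sub PQ by simp
qed

text \<open>Turns an anonymous list of shares back into an assignment \<open>g\<close> of pieces to
  students, by splitting off the last share.\<close>

lemma mset_set_partition:
  fixes D :: "nat \<Rightarrow> 'b multiset"
  assumes "finite H" "image_mset f (mset_set H) = (\<Sum>j<s. D j)"
  shows "\<exists>g. (\<forall>p\<in>H. g p < s) \<and> (\<forall>j<s. image_mset f (mset_set {p\<in>H. g p = j}) = D j)"
  using assms
proof (induction s arbitrary: H)
  case 0
  then show ?case by (auto simp: mset_set_empty_iff)
next
  case (Suc s)
  obtain K where K: "K \<subseteq> H" "image_mset f (mset_set K) = (\<Sum>j<s. D j)"
     "image_mset f (mset_set (H - K)) = D s"
    using image_mset_mset_set_split[OF Suc.prems(1), of f "\<Sum>j<s. D j" "D s"] Suc.prems(2) by auto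
  obtain g where g: "\<forall>p\<in>K. g p < s" "\<forall>j<s. image_mset f (mset_set {p\<in>K. g p = j}) = D j"
    using Suc.IH[OF finite_subset[OF K(1) Suc.prems(1)] K(2)] by blast
  let ?g = "\<lambda>p. if p \<in> K then g p else s"
  have "{p\<in>H. ?g p = j} = {p\<in>K. g p = j}" if "j < s" for j using that K(1) by auto
  moreover have "{p\<in>H. ?g p = s} = H - K" using g(1) K(1) by auto
  ultimately show ?case
    by (intro exI[of _ ?g]) (use g K in \<open>auto simp: less_Suc_eq\<close>)
qed

lemma sum_mset_image_single [simp]: "sum_mset (image_mset (\<lambda>x. {#f x#}) X) = image_mset f X"
  by (induction X) auto

text \<open>
  A student is represented by the multiset of its piece sizes, and X lists one of the two pieces
  of every muffin.
\<close>

definition halved :: "nat \<Rightarrow> nat \<Rightarrow> real \<Rightarrow> real multiset multiset \<Rightarrow> bool" where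
  "halved m s t \<D> \<longleftrightarrow> size \<D> = s \<and>
     (\<forall>D\<in>#\<D>. sum_mset D = real m / real s \<and> (\<forall>x\<in>#D. t \<le> x)) \<and>
     (\<exists>X. size X = m \<and> sum_mset \<D> = X + image_mset (\<lambda>x. 1 - x) X)"

lemma sum_mset_conv_nth: "mset ds = \<D> \<Longrightarrow> sum_mset \<D> = (\<Sum>j<length ds. ds ! j)"
  by (metis sum_mset_sum_list sum_list_sum_nth lessThan_atLeast0)

lemma pair_fibre: "{p. p < 2 * m \<and> p div 2 = i} = (if i < m then {2*i, 2*i+1} else {})" for m i :: nat
  by auto

lemma image_mset_mset_set_pairs:
  "image_mset f (mset_set {..<2*m}) = (\<Sum>i<m. {#f (2*i), f (2*i+1)#})" for m :: nat
  by (induction m) (auto simp: lessThan_Suc)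

lemma sum_fibre_mset:
  "finite H \<Longrightarrow> image_mset f (mset_set {p\<in>H. P p}) = D \<Longrightarrow> (\<Sum>p\<in>{p\<in>H. P p}. f p) = sum_mset D"
  by (auto simp: sum_unfold_sum_mset)

lemma card_fibre_mset:
  "finite H \<Longrightarrow> image_mset f (mset_set {p\<in>H. P p}) = D \<Longrightarrow> card {p\<in>H. P p} = size D"
  by auto

text \<open>Muffin i consists of the pieces 2 * i and 2 * i + 1, of sizes x and 1 - x for the i-th
  element x of \<open>X\<close>, and \<open>mset_set_partition\<close> hands the pieces out. The
  piece counts are recorded because fully-constrained procedures restrict them.\<close>

lemma proc_of_halved:
  assumes "halved m s t \<D>" "t > 0"
  obtains st sz where "muffin_proc m s (2*m) (\<lambda>p. p div 2) st sz" "\<forall>p<2*m. t \<le> sz p"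
    "\<forall>j<s. \<exists>D\<in>#\<D>. card {p. p < 2*m \<and> st p = j} = size D"
proof -
  obtain X where X: "size X = m" "sum_mset \<D> = X + image_mset (\<lambda>x. 1 - x) X"
    using assms(1) unfolding halved_def by auto
  obtain xs where xs: "mset xs = X" using ex_mset by blast
  obtain ds where ds: "mset ds = \<D>" using ex_mset by blast
  have len: "length xs = m" "length ds = s" using xs ds X assms(1)
    by (auto simp: halved_def simp flip: size_mset)
  have single: "(\<Sum>i<m. {#h (xs ! i)#}) = image_mset h X" for h :: "real \<Rightarrow> real"
    using sum_mset_conv_nth[of "map (\<lambda>x. {#h x#}) xs", OF refl] xs len by simp
  define sz where "sz p = (if even p then xs ! (p div 2) else 1 - xs ! (p div 2))" for p
  have "image_mset sz (mset_set {..<2*m}) = (\<Sum>i<m. {#xs ! i#}) + (\<Sum>i<m. {#1 - xs ! i#})"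
    by (simp add: image_mset_mset_set_pairs sz_def add_mset_commute flip: sum.distrib)
  also have "(\<Sum>i<m. {#xs ! i#}) + (\<Sum>i<m. {#1 - xs ! i#}) = sum_mset \<D>"
    using single[of "\<lambda>x. x"] single[of "\<lambda>x. 1 - x"] X by simp
  finally have "image_mset sz (mset_set {..<2*m}) = (\<Sum>j<s. ds ! j)"
    using sum_mset_conv_nth[OF ds] len by simp
  from mset_set_partition[OF _ this] obtain st where
    st: "\<forall>p<2*m. st p < s" "\<forall>j<s. image_mset sz (mset_set {p\<in>{..<2*m}. st p = j}) = ds ! j" by auto
  have mem: "ds ! j \<in># \<D>" if "j < s" for j using that len ds by auto
  have ge: "t \<le> sz p" if "p < 2*m" for p
  proof -
    have "p \<in># mset_set {q\<in>{..<2*m}. st q = st p}" using that by simp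
    then have "sz p \<in># image_mset sz (mset_set {q\<in>{..<2*m}. st q = st p})"
      unfolding set_image_mset by (rule imageI)
    then have "sz p \<in># ds ! (st p)" using st that by metis
    then show ?thesis using mem st(1) that assms(1) unfolding halved_def by blast
  qed
  have set_eq: "{p. p < 2*m \<and> st p = j} = {p\<in>{..<2*m}. st p = j}" for j by auto
  have "muffin_proc m s (2*m) (\<lambda>p. p div 2) st sz"
    unfolding muffin_proc_def
  proof (intro conjI allI impI)
    fix p assume "p < 2*m"
    then show "p div 2 < m" "st p < s" "sz p > 0" using st ge[of p] assms(2) by auto
  next
    fix i assume "i < m"
    then show "(\<Sum>p\<in>{p. p < 2*m \<and> p div 2 = i}. sz p) = 1" by (simp add: pair_fibre sz_def)
  next
    fix j assume j: "j < s"
    then show "(\<Sum>p\<in>{p. p < 2*m \<and> st p = j}. sz p) = real m / real s"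
      unfolding set_eq using sum_fibre_mset[of "{..<2*m}" sz "\<lambda>p. st p = j"] st(2) mem[OF j] assms(1)
      by (auto simp: halved_def)
  qed
  moreover have "\<forall>j<s. \<exists>D\<in>#\<D>. card {p. p < 2*m \<and> st p = j} = size D"
  proof (intro allI impI)
    fix j assume j: "j < s"
    have "card {p\<in>{..<2*m}. st p = j} = size (ds ! j)"
      by (rule card_fibre_mset[of _ sz]) (use st(2) j in auto)
    then show "\<exists>D\<in>#\<D>. card {p. p < 2*m \<and> st p = j} = size D"
      using mem[OF j] unfolding set_eq by blast
  qed
  ultimately show thesis using that ge by blast
qed

lemma halved_of_proc:
  assumes "muffin_proc m s (2*m) (\<lambda>p. p div 2) st sz" "\<forall>p<2*m. t \<le> sz p"
  shows "\<exists>\<D>. halved m s t \<D>"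
proof -
  define D where "D j = image_mset sz (mset_set {p\<in>{..<2*m}. st p = j})" for j
  define X where "X = image_mset (\<lambda>i. sz (2*i)) (mset_set {..<m})"
  have set_eq: "{p. p < 2*m \<and> st p = j} = {p\<in>{..<2*m}. st p = j}" for j by auto
  have one: "sz (2*i+1) = 1 - sz (2*i)" if "i < m" for i
    using assms(1) that unfolding muffin_proc_def pair_fibre by auto
  have "sum_mset (image_mset D (mset_set {..<s})) = image_mset sz (mset_set {..<2*m})"
    unfolding sum_unfold_sum_mset[symmetric] D_def
    by (rule image_mset_conv_sum_fibres[symmetric]) (use assms(1) in \<open>auto simp: muffin_proc_def\<close>)
  also have "\<dots> = X + image_mset (\<lambda>x. 1 - x) X"
    using one unfolding X_def image_mset_mset_set_pairs image_mset.compositionality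
    by (simp add: o_def image_mset_mset_set_conv_sum add_mset_commute flip: sum.distrib)
  finally have "\<exists>X. size X = m \<and> sum_mset (image_mset D (mset_set {..<s})) = X + image_mset (\<lambda>x. 1 - x) X"
    by (intro exI[of _ X]) (simp add: X_def)
  then have "halved m s t (image_mset D (mset_set {..<s}))"
    using assms unfolding halved_def muffin_proc_def set_eq
    by (auto simp: D_def sum_unfold_sum_mset)
  then show ?thesis by blast
qed

subsection \<open>Contracting and merging students\<close>

text \<open>A fixed-point-free involution, joining first the two pieces of a muffin and later the
  two ends of a chain.\<close>

definition pairing :: "'p set \<Rightarrow> ('p \<Rightarrow> 'p) \<Rightarrow> bool" where
  "pairing H \<tau> \<longleftrightarrow> (\<forall>p\<in>H. \<tau> p \<in> H \<and> \<tau> p \<noteq> p \<and> \<tau> (\<tau> p) = p)"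

lemma pairing_sum: "pairing H \<tau> \<Longrightarrow> (\<Sum>p\<in>H. f (\<tau> p)) = sum f H"
  by (rule sum.reindex_bij_witness[of _ \<tau> \<tau>]) (auto simp: pairing_def)

text \<open>The smaller index of every pair goes into \<open>X\<close>; this choice uses the order
  of the natural numbers.\<close>

lemma pairing_mset:
  fixes H :: "nat set"
  assumes "finite H" "pairing H \<tau>" "\<And>p. p \<in> H \<Longrightarrow> f (\<tau> p) = g (f p)"
  shows "\<exists>X. image_mset f (mset_set H) = X + image_mset g X"
proof -
  let ?K = "{p\<in>H. p < \<tau> p}" and ?L = "{p\<in>H. \<tau> p < p}"
  have "p < \<tau> p \<or> \<tau> p < p" if "p \<in> H" for p
    using assms(2) that unfolding pairing_def by (metis linorder_neqE_nat)
  then have H: "H = ?K \<union> ?L" by auto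
  have "(\<Sum>p\<in>?L. {#f p#}) = (\<Sum>p\<in>?K. {#g (f p)#})"
  proof (rule sum.reindex_bij_witness[of _ \<tau> \<tau>])
    fix p assume "p \<in> ?L"
    then show "{#g (f (\<tau> p))#} = {#f p#}" using assms(2,3) unfolding pairing_def by (metis (lifting) mem_Collect_eq)
  qed (use assms(2) in \<open>auto simp: pairing_def\<close>)
  then have "image_mset f (mset_set ?L) = image_mset g (image_mset f (mset_set ?K))"
    using assms(1) by (simp add: multiset.map_comp o_def flip: image_mset_mset_set_conv_sum)
  moreover have "image_mset f (mset_set H) = image_mset f (mset_set ?K) + image_mset f (mset_set ?L)"
    by (subst H, subst mset_set_Union) (use assms(1) in auto)
  ultimately show ?thesis by auto
qed

text \<open>
  Removing a two-piece student joins the chains ending in its two pieces; k counts the students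
  on a chain. No chain closes up, since its end pieces would sum to 1 + \<delta> > 1.
\<close>

lemma contract_two_piece_classes:
  fixes sz :: "'p \<Rightarrow> real"
  assumes "finite T" "\<delta> > 0" "pairing H \<tau>"
    and "\<And>p. p \<in> H \<Longrightarrow> sz p + sz (\<tau> p) = 1 - real (k p) * \<delta>"
    and "\<And>v. v \<in> T \<Longrightarrow> card {p\<in>H. c p = v} = 2 \<and> (\<Sum>p\<in>{p\<in>H. c p = v}. sz p) = 1 + \<delta>"
  shows "\<exists>\<tau>' k'. pairing {p\<in>H. c p \<notin> T} \<tau>' \<and>
    (\<forall>p\<in>{p\<in>H. c p \<notin> T}. sz p + sz (\<tau>' p) = 1 - real (k' p) * \<delta>)"
  using assms
proof (induction T arbitrary: H \<tau> k rule: finite_induct)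
  case empty
  then show ?case by auto
next
  case (insert v T)
  obtain p q where pq: "{p\<in>H. c p = v} = {p, q}" "p \<noteq> q"
    using insert.prems(4)[of v] by (auto simp: card_2_iff)
  have sum_pq: "sz p + sz q = 1 + \<delta>" using insert.prems(4)[of v] pq by simp
  have pH: "p \<in> H" "q \<in> H" "c p = v" "c q = v" using pq by auto
  have \<tau>: "\<tau> r \<in> H" "\<tau> r \<noteq> r" "\<tau> (\<tau> r) = r" if "r \<in> H" for r
    using insert.prems(2) that by (auto simp: pairing_def)
  have ne: "\<tau> p \<noteq> q"
  proof
    assume "\<tau> p = q"
    then have "1 + \<delta> = 1 - real (k p) * \<delta>" using insert.prems(3)[OF pH(1)] sum_pq by simp
    then have "\<delta> * (1 + real (k p)) = 0" by (simp add: algebra_simps)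
    then show False using insert.prems(1) by (simp add: add_eq_0_iff)
  qed
  define H1 where "H1 = H - {p, q}"
  \<comment> \<open>The far ends of the chains at p and q become partners. The removed student
    accounts for the extra 1 in \<open>k1\<close>, since 2 - (1 + \<delta>) = 1 - \<delta>.\<close>
  define \<tau>1 where "\<tau>1 = \<tau>(\<tau> p := \<tau> q, \<tau> q := \<tau> p)"
  define k1 where "k1 = k(\<tau> p := k p + k q + 1, \<tau> q := k p + k q + 1)"
  have inj: "\<tau> r = \<tau> r' \<longleftrightarrow> r = r'" if "r \<in> H" "r' \<in> H" for r r' using \<tau> that by metis
  have "pairing H1 \<tau>1"
    unfolding pairing_def
  proof
    fix r assume "r \<in> H1"
    then have r: "r \<in> H" "r \<noteq> p" "r \<noteq> q" by (auto simp: H1_def)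
    consider "r = \<tau> p" | "r = \<tau> q" | "r \<noteq> \<tau> p" "r \<noteq> \<tau> q" by blast
    then show "\<tau>1 r \<in> H1 \<and> \<tau>1 r \<noteq> r \<and> \<tau>1 (\<tau>1 r) = r"
    proof cases
      case 3
      have "\<tau> r \<noteq> p" "\<tau> r \<noteq> q" using 3 \<tau>(3)[OF r(1)] by auto
      then show ?thesis using 3 r \<tau>[OF r(1)] inj[OF r(1) pH(1)] inj[OF r(1) pH(2)]
        by (auto simp: \<tau>1_def H1_def)
    qed (use r pH \<tau> inj[of p q] ne pq(2) in \<open>auto simp: \<tau>1_def H1_def\<close>)
  qed
  moreover have "sz r + sz (\<tau>1 r) = 1 - real (k1 r) * \<delta>" if "r \<in> H1" for r
  proof -
    have "sz (\<tau> p) + sz (\<tau> q) = 1 - real (k p + k q + 1) * \<delta>"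
      using insert.prems(3)[OF pH(1)] insert.prems(3)[OF pH(2)] sum_pq by (simp add: algebra_simps)
    then show ?thesis using insert.prems(3)[of r] that inj[of p q] pH pq(2)
      by (auto simp: \<tau>1_def k1_def H1_def)
  qed
  moreover have "{r\<in>H1. c r = w} = {r\<in>H. c r = w}" if "w \<in> T" for w
    using that insert.hyps pH by (auto simp: H1_def)
  ultimately have "\<exists>\<tau>' k'. pairing {p\<in>H1. c p \<notin> T} \<tau>' \<and>
    (\<forall>p\<in>{p\<in>H1. c p \<notin> T}. sz p + sz (\<tau>' p) = 1 - real (k' p) * \<delta>)"
    using insert.prems(1,4) by (intro insert.IH[of H1 \<tau>1 k1]) auto
  moreover have "{r\<in>H1. c r \<notin> T} = {r\<in>H. c r \<notin> insert v T}"
    using pq pH insert.hyps by (auto simp: H1_def)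
  ultimately show ?case by simp
qed

text \<open>
  Merging two classes along a pair of total a keeps class sums at a: a + a - a. A pair inside one
  class is impossible, because the at least one remaining positive value would have sum 0.
\<close>

lemma merge_classes:
  fixes u :: "'p \<Rightarrow> real" and c :: "'p \<Rightarrow> 'v"
  assumes "a \<noteq> e" "finite H" "finite S" "c ` H \<subseteq> S" "pairing H \<tau>"
    and "\<And>p. p \<in> H \<Longrightarrow> u p > 0 \<and> (u p + u (\<tau> p) = a \<or> u p + u (\<tau> p) = e)"
    and "\<And>v. v \<in> S \<Longrightarrow> card {p\<in>H. c p = v} \<ge> 3 \<and> (\<Sum>p\<in>{p\<in>H. c p = v}. u p) = a"
  shows "\<exists>(S' :: 'v set) c'. finite S' \<and> c' ` {p\<in>H. u p + u (\<tau> p) = e} \<subseteq> S' \<and>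
    pairing {p\<in>H. u p + u (\<tau> p) = e} \<tau> \<and>
    (\<forall>v\<in>S'. (\<Sum>p\<in>{p\<in>{p\<in>H. u p + u (\<tau> p) = e}. c' p = v}. u p) = a)"
  using assms(2-)
proof (induction "card {p\<in>H. u p + u (\<tau> p) = a}" arbitrary: H S c rule: less_induct)
  case less
  show ?case
  proof (cases "{p\<in>H. u p + u (\<tau> p) = a} = {}")
    case True
    then have "{p\<in>H. u p + u (\<tau> p) = e} = H" using less.prems(5) by blast
    then show ?thesis using less.prems by (intro exI[of _ S] exI[of _ c]) simp
  next
    case False
    then obtain p where p: "p \<in> H" "u p + u (\<tau> p) = a" by auto
    define q where "q = \<tau> p"
    have \<tau>: "\<tau> r \<in> H" "\<tau> r \<noteq> r" "\<tau> (\<tau> r) = r" if "r \<in> H" for r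
      using less.prems(4) that by (auto simp: pairing_def)
    have q: "q \<in> H" "q \<noteq> p" "\<tau> q = p" "u p + u q = a" "u q + u (\<tau> q) = a"
      using \<tau>[OF p(1)] p(2) by (auto simp: q_def)
    define C where "C v = {r\<in>H. c r = v}" for v
    have finC: "finite (C v)" for v using less.prems(1) by (simp add: C_def)
    have C: "card (C v) \<ge> 3" "sum u (C v) = a" if "v \<in> S" for v
      using less.prems(6)[OF that] by (auto simp: C_def)
    have cS: "c p \<in> S" "c q \<in> S" using less.prems(3) p q by auto
    have ne: "c p \<noteq> c q"
    proof
      assume eq: "c p = c q"
      have sub: "{p, q} \<subseteq> C (c p)" using p q eq by (auto simp: C_def)
      have "sum u (C (c p) - {p, q}) = 0"
        using sum_diff[OF finC sub, of u] C(2)[OF cS(1)] q by simp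
      moreover have "card (C (c p) - {p, q}) \<ge> 1"
        using card_Diff_subset[OF _ sub] C(1)[OF cS(1)] q by simp
      then have "C (c p) - {p, q} \<noteq> {}" by (metis card.empty not_one_le_zero)
      then have "sum u (C (c p) - {p, q}) > 0"
        using finC less.prems(5) by (intro sum_pos) (auto simp: C_def)
      ultimately show False by simp
    qed
    define H1 where "H1 = H - {p, q}"
    define S1 where "S1 = S - {c q}"
    define c1 where "c1 r = (if c r = c q then c p else c r)" for r
    have e_eq: "{r\<in>H1. u r + u (\<tau> r) = e} = {r\<in>H. u r + u (\<tau> r) = e}"
      using p q assms(1) by (auto simp: H1_def)
    have "{r\<in>H1. u r + u (\<tau> r) = a} \<subset> {r\<in>H. u r + u (\<tau> r) = a}"
      using p q by (auto simp: H1_def)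
    then have "card {r\<in>H1. u r + u (\<tau> r) = a} < card {r\<in>H. u r + u (\<tau> r) = a}"
      using less.prems(1) by (intro psubset_card_mono) auto
    moreover have "finite H1" "finite S1" using less.prems by (auto simp: H1_def S1_def)
    moreover have "c1 ` H1 \<subseteq> S1" using less.prems(3) ne cS by (auto simp: c1_def H1_def S1_def)
    moreover have "pairing H1 \<tau>"
      unfolding pairing_def
    proof
      fix r assume "r \<in> H1"
      then have r: "r \<in> H" "r \<noteq> p" "r \<noteq> q" by (auto simp: H1_def)
      then have "\<tau> r \<noteq> p" "\<tau> r \<noteq> q" using \<tau>(3)[OF r(1)] q q_def \<tau>(3)[OF p(1)] by metis+
      then show "\<tau> r \<in> H1 \<and> \<tau> r \<noteq> r \<and> \<tau> (\<tau> r) = r" using \<tau>[OF r(1)] by (auto simp: H1_def)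
    qed
    moreover have "u r > 0 \<and> (u r + u (\<tau> r) = a \<or> u r + u (\<tau> r) = e)" if "r \<in> H1" for r
      using less.prems(5) that by (auto simp: H1_def)
    moreover have "card {r\<in>H1. c1 r = v} \<ge> 3 \<and> sum u {r\<in>H1. c1 r = v} = a" if v: "v \<in> S1" for v
    proof (cases "v = c p")
      case True
      have pC: "p \<in> C (c p)" "q \<in> C (c q)" using p q by (auto simp: C_def)
      have set_eq: "{r\<in>H1. c1 r = v} = (C (c p) - {p}) \<union> (C (c q) - {q})"
        using True ne q by (auto simp: H1_def c1_def C_def)
      have disj: "(C (c p) - {p}) \<inter> (C (c q) - {q}) = {}" using ne by (auto simp: C_def)
      \<comment> \<open>Each of the two classes loses one piece, so at least 2 + 2 pieces remain and
        the bound of three persists.\<close>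
      have "card {r\<in>H1. c1 r = v} = (card (C (c p)) - 1) + (card (C (c q)) - 1)"
        unfolding set_eq using disj finC pC by (subst card_Un_disjoint) auto
      moreover have "sum u {r\<in>H1. c1 r = v} = (a - u p) + (a - u q)"
        unfolding set_eq using disj finC pC C(2)[OF cS(1)] C(2)[OF cS(2)]
        by (subst sum.union_disjoint) (auto simp: sum_diff1)
      ultimately show ?thesis using C(1)[OF cS(1)] C(1)[OF cS(2)] q by auto
    next
      case False
      then have "{r\<in>H1. c1 r = v} = C v" using v by (auto simp: H1_def c1_def C_def S1_def)
      then show ?thesis using C[of v] v by (simp add: S1_def)
    qed
    ultimately show ?thesis using less.hyps[of H1 S1 c1] unfolding e_eq by blast
  qed
qed

subsection \<open>The upper bound\<close>

lemma muffin_proc_pos: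
  assumes "muffin_proc m s k mu st sz" "m \<ge> 1"
  shows "k \<ge> 1"
proof (rule ccontr)
  assume "\<not> k \<ge> 1"
  then have "k = 0" by simp
  then show False using assms by (auto simp: muffin_proc_def)
qed

lemma smallest_piece_ge_iff: "k \<ge> 1 \<Longrightarrow> t \<le> smallest_piece k sz \<longleftrightarrow> (\<forall>p<k. t \<le> sz p)"
  unfolding smallest_piece_def by (subst Min_ge_iff) (auto simp: lessThan_empty_iff)

lemma smallest_piece_le: "p < k \<Longrightarrow> smallest_piece k sz \<le> sz p"
  unfolding smallest_piece_def by (rule Min_le) auto

lemma piece_le_1:
  assumes "muffin_proc m s k mu st sz" "p < k"
  shows "sz p \<le> 1"
proof -
  have "sz p \<le> (\<Sum>q\<in>{q. q < k \<and> mu q = mu p}. sz q)"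
    by (rule member_le_sum) (use assms in \<open>auto simp: muffin_proc_def less_imp_le\<close>)
  also have "\<dots> = 1" using assms by (auto simp: muffin_proc_def)
  finally show ?thesis .
qed

text \<open>No piece exceeds its muffin, so the set of values is bounded by 1 and \<open>Sup\<close>
  is a genuine supremum.\<close>

lemma smallest_piece_le_muffin_f:
  assumes "muffin_proc m s k mu st sz" "m \<ge> 1"
  shows "smallest_piece k sz \<le> muffin_f m s"
proof -
  let ?V = "{smallest_piece k sz | k mu st sz. muffin_proc m s k mu st sz}"
  have "v \<le> 1" if v: "v \<in> ?V" for v
  proof -
    obtain k mu st sz where v': "v = smallest_piece k sz" "muffin_proc m s k mu st sz"
      using v by blast
    have "0 < k" using muffin_proc_pos[OF v'(2) assms(2)] by simp
    then show ?thesis using smallest_piece_le[of 0 k sz] piece_le_1[OF v'(2)] v'(1) by force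
  qed
  then have "bdd_above ?V" by (rule bdd_aboveI)
  then show ?thesis unfolding muffin_f_def by (intro cSup_upper) (use assms in blast)
qed

lemma halved_le_muffin_f:
  assumes "halved m s t \<D>" "t > 0" "m \<ge> 1"
  shows "t \<le> muffin_f m s"
proof -
  obtain st sz where "muffin_proc m s (2*m) (\<lambda>p. p div 2) st sz" "\<forall>p<2*m. t \<le> sz p"
    using proc_of_halved[OF assms(1,2)] by metis
  then show ?thesis
    using smallest_piece_le_muffin_f[of m s "2*m" "\<lambda>p. p div 2" st sz] assms(3)
      smallest_piece_ge_iff[of "2*m" t sz] by force
qed

lemma card_eq_sum_fibres:
  assumes "finite H" "finite S" "c ` H \<subseteq> S"
  shows "card H = (\<Sum>v\<in>S. card {p\<in>H. c p = v})"
  using sum.group[OF assms, of "\<lambda>_. 1::nat"] by simp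

section \<open>Chains between three-piece students\<close>

lemma fc_proc_card:
  assumes "fc_proc m s k mu st sz"
  shows "k = 2 * m" "(\<Sum>j<s. card {p. p < k \<and> st p = j}) = 2 * m"
proof -
  have mp: "mu ` {..<k} \<subseteq> {..<m}" "st ` {..<k} \<subseteq> {..<s}"
    using assms by (auto simp: fc_proc_def muffin_proc_def)
  show "k = 2 * m"
    using card_eq_sum_fibres[OF _ _ mp(1)] assms by (simp add: fc_proc_def)
  then show "(\<Sum>j<s. card {p. p < k \<and> st p = j}) = 2 * m"
    using card_eq_sum_fibres[OF _ _ mp(2)] by simp
qed

text \<open>There are more muffins than students, so the average number of pieces exceeds two and
  some student gets at least three. For a = 0 the bound equals d * b / s, the claimed
  optimum.\<close>

lemma fc_proc_smallest_le_third:
  assumes "fc_proc (s + d) s k mu st sz" "d \<ge> 1" "s \<ge> 1"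
  shows "smallest_piece k sz \<le> real (s + d) / (3 * real s)"
proof -
  let ?C = "\<lambda>j. {p. p < k \<and> st p = j}"
  have "\<exists>j<s. card (?C j) \<ge> 3"
  proof (rule ccontr)
    assume "\<not> ?thesis"
    then have "(\<Sum>j<s. card (?C j)) \<le> (\<Sum>j<s. 2)" by (intro sum_mono) force
    then show False using fc_proc_card(2)[OF assms(1)] assms(2) by simp
  qed
  then obtain j where j: "j < s" "card (?C j) \<ge> 3" by blast
  let ?v = "smallest_piece k sz"
  have mp: "muffin_proc (s + d) s k mu st sz" using assms(1) by (simp add: fc_proc_def)
  have "?v > 0"
  proof -
    have "k \<ge> 1" using muffin_proc_pos[OF mp] assms by simp
    then have "?v \<in> sz ` {..<k}" unfolding smallest_piece_def by (intro Min_in) (auto simp: lessThan_empty_iff)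
    then show ?thesis using mp by (auto simp: muffin_proc_def)
  qed
  then have "3 * ?v \<le> real (card (?C j)) * ?v" using j(2) by (intro mult_right_mono) auto
  also have "\<dots> \<le> (\<Sum>p\<in>?C j. sz p)" by (rule sum_bounded_below) (auto intro: smallest_piece_le)
  also have "\<dots> = real (s + d) / real s" using mp j(1) by (simp add: muffin_proc_def)
  finally show ?thesis by (simp add: field_simps)
qed

lemma fc_proc_partner:
  assumes "fc_proc m s k mu st sz"
  shows "\<exists>\<tau>. pairing {..<k} \<tau> \<and> (\<forall>p<k. sz p + sz (\<tau> p) = 1)"
proof -
  define \<tau> where "\<tau> p = (SOME q. q < k \<and> mu q = mu p \<and> q \<noteq> p)" for p
  have fibre: "{q. q < k \<and> mu q = mu p} = {p, \<tau> p} \<and> \<tau> p \<noteq> p" if p: "p < k" for p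
  proof -
    let ?F = "{q. q < k \<and> mu q = mu p}"
    have "mu p < m" using assms p by (auto simp: fc_proc_def muffin_proc_def)
    then have "card ?F = 2" using assms by (simp add: fc_proc_def)
    then obtain x y where xy: "?F = {x, y}" "x \<noteq> y" by (auto simp: card_2_iff)
    have "p \<in> ?F" using p by simp
    then have "\<exists>q. q \<in> ?F \<and> q \<noteq> p" using xy by auto
    then have "\<tau> p \<in> ?F \<and> \<tau> p \<noteq> p"
      unfolding \<tau>_def using someI_ex[of "\<lambda>q. q < k \<and> mu q = mu p \<and> q \<noteq> p"] by simp
    then show ?thesis using xy \<open>p \<in> ?F\<close> by auto
  qed
  have "pairing {..<k} \<tau>"
    unfolding pairing_def
  proof
    fix p assume "p \<in> {..<k}"
    then have p: "p < k" by simp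
    have q: "\<tau> p < k" "mu (\<tau> p) = mu p" using fibre[OF p] by auto
    then show "\<tau> p \<in> {..<k} \<and> \<tau> p \<noteq> p \<and> \<tau> (\<tau> p) = p"
      using fibre[OF p] fibre[OF q(1)] by (auto simp: doubleton_eq_iff)
  qed
  moreover have "sz p + sz (\<tau> p) = 1" if p: "p < k" for p
  proof -
    have "mu p < m" using assms p by (auto simp: fc_proc_def muffin_proc_def)
    then have "(\<Sum>q\<in>{q. q < k \<and> mu q = mu p}. sz q) = 1"
      using assms by (simp add: fc_proc_def muffin_proc_def)
    then show ?thesis using fibre[OF p] by simp
  qed
  ultimately show ?thesis by blast
qed

text \<open>Since 2 \<le> 2 * m / s < 3, students have two or three pieces, and counting all 2 * m
  pieces leaves 2 * d students with three. Contracting the others yields \<tau> and \<kappa>. The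
  total of \<kappa> is twice the number s - 2 * d of two-piece students, as every chain is seen from
  both ends; it is obtained by comparing total sizes, not by tracking the contraction.\<close>

lemma fc_proc_chains:
  assumes "fc_proc (s + d) s k mu st sz" "d \<ge> 1" "s > 2 * d"
  shows "\<exists>S \<tau> \<kappa>. S \<subseteq> {..<s} \<and> card S = 2 * d \<and> pairing {p\<in>{..<k}. st p \<in> S} \<tau> \<and>
    (\<forall>v\<in>S. card {p. p < k \<and> st p = v} = 3) \<and>
    (\<forall>p\<in>{p\<in>{..<k}. st p \<in> S}. sz p + sz (\<tau> p) = 1 - real (\<kappa> p) * (real d / real s)) \<and>
    (\<Sum>p\<in>{p\<in>{..<k}. st p \<in> S}. real (\<kappa> p)) = 2 * (real s - 2 * real d)"
proof -
  define \<delta> where "\<delta> = real d / real s"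
  have \<delta>: "\<delta> > 0" using assms by (simp add: \<delta>_def)
  have mp: "muffin_proc (s + d) s k mu st sz" using assms(1) by (simp add: fc_proc_def)
  have "(2 * (s + d)) div s = 2"
    using assms(3) by (intro div_nat_eqI) auto
  then have card23: "card {p. p < k \<and> st p = j} \<in> {2, 3}" if "j < s" for j
    using assms(1) that by (simp add: fc_proc_def)
  define T where "T = {j. j < s \<and> card {p. p < k \<and> st p = j} = 2}"
  define S where "S = {j. j < s \<and> card {p. p < k \<and> st p = j} = 3}"
  have fin: "finite T" "finite S" and disj: "T \<inter> S = {}" and un: "{..<s} = T \<union> S"
    using card23 by (auto simp: T_def S_def)
  have "card T + card S = s" using card_Un_disjoint[OF fin disj] un by (metis card_lessThan)
  moreover have "(\<Sum>j<s. card {p. p < k \<and> st p = j}) = card T * 2 + card S * 3"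
    unfolding un by (subst sum.union_disjoint) (use fin disj in \<open>auto simp: T_def S_def\<close>)
  ultimately have cardS: "card S = 2 * d" using fc_proc_card(2)[OF assms(1)] by simp
  have share: "(\<Sum>p\<in>{p\<in>{..<k}. st p = v}. sz p) = 1 + \<delta>" if "v < s" for v
    using mp that assms(2,3) by (simp add: muffin_proc_def \<delta>_def field_simps)
  define H where "H = {p\<in>{..<k}. st p \<in> S}"
  have H: "H = {p\<in>{..<k}. st p \<notin> T}"
    using mp card23 by (auto simp: H_def S_def T_def muffin_proc_def)
  obtain \<tau>0 where \<tau>0: "pairing {..<k} \<tau>0" "\<forall>p<k. sz p + sz (\<tau>0 p) = 1"
    using fc_proc_partner[OF assms(1)] by blast
  have "\<exists>\<tau> \<kappa>. pairing H \<tau> \<and> (\<forall>p\<in>H. sz p + sz (\<tau> p) = 1 - real (\<kappa> p) * \<delta>)"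
    unfolding H
    by (rule contract_two_piece_classes[OF fin(1) \<delta> \<tau>0(1), of _ "\<lambda>_. 0"])
      (use \<tau>0(2) share in \<open>auto simp: T_def\<close>)
  then obtain \<tau> \<kappa> where \<tau>: "pairing H \<tau>" and \<kappa>: "\<forall>p\<in>H. sz p + sz (\<tau> p) = 1 - real (\<kappa> p) * \<delta>"
    by blast
  have finH: "finite H" by (simp add: H_def)
  have stH: "st ` H \<subseteq> S" by (auto simp: H_def)
  have fib: "{p\<in>H. st p = v} = {p\<in>{..<k}. st p = v}" if "v \<in> S" for v
    using that by (auto simp: H_def)
  have cardH: "card H = 6 * d"
    using card_eq_sum_fibres[OF finH fin(2) stH] cardS
    by (simp add: fib sum.cong[OF refl, of S _ "\<lambda>_. 3"] S_def)
  have sumH: "sum sz H = 2 * real d * (1 + \<delta>)"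
  proof -
    have "sum sz H = (\<Sum>v\<in>S. \<Sum>p\<in>{p\<in>H. st p = v}. sz p)"
      by (rule sum.group[symmetric]) (use finH fin stH in auto)
    also have "\<dots> = (\<Sum>v\<in>S. 1 + \<delta>)"
      by (rule sum.cong[OF refl]) (use fib share in \<open>auto simp: S_def\<close>)
    finally show ?thesis using cardS by simp
  qed
  have "(\<Sum>p\<in>H. sz p + sz (\<tau> p)) = (\<Sum>p\<in>H. 1 - real (\<kappa> p) * \<delta>)" using \<kappa> by (intro sum.cong) auto
  then have "2 * sum sz H = real (card H) - (\<Sum>p\<in>H. real (\<kappa> p)) * \<delta>"
    by (simp add: sum.distrib sum_subtractf pairing_sum[OF \<tau>] sum_distrib_right)
  then have "(\<Sum>p\<in>H. real (\<kappa> p)) * \<delta> = 2 * real d - 4 * real d * \<delta>"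
    using sumH cardH by (simp add: algebra_simps)
  moreover have "real d = real s * \<delta>" using assms by (simp add: \<delta>_def)
  ultimately have "(\<Sum>p\<in>H. real (\<kappa> p)) * \<delta> = (2 * (real s - 2 * real d)) * \<delta>"
    by (simp add: algebra_simps)
  then have "(\<Sum>p\<in>H. real (\<kappa> p)) = 2 * (real s - 2 * real d)" using \<delta> by simp
  then show ?thesis using cardS \<tau> \<kappa> unfolding H_def \<delta>_def
    by (intro exI[of _ S] exI[of _ \<tau>] exI[of _ \<kappa>]) (auto simp: S_def)
qed

text \<open>Multiplying by s and subtracting d * b turns a share m / s in three pieces into m - 3 *
  d * b = a. With \<kappa> = b - 1 + j a chain total becomes a - j * d; \<open>j\<close> is an
  integer because \<kappa> may be below b - 1. Over the 6 * d ends, 2 * (s - 2 * d) - 6 * d * (b -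
  1) = 2 * a.\<close>

lemma fc_proc_scaled:
  assumes "fc_proc (3*d*b + a) (3*d*b + a - d) k mu st sz" "d \<ge> 1" "b \<ge> 1" "a \<ge> 1"
  defines "u \<equiv> \<lambda>p. real (3*d*b + a - d) * sz p - real d * real b"
  shows "\<exists>S \<tau> j. finite S \<and> card S = 2 * d \<and> pairing {p\<in>{..<k}. st p \<in> S} \<tau> \<and>
    (\<forall>v\<in>S. card {p. p < k \<and> st p = v} = 3 \<and> (\<Sum>p\<in>{p. p < k \<and> st p = v}. u p) = real a) \<and>
    (\<forall>p\<in>{p\<in>{..<k}. st p \<in> S}. u p + u (\<tau> p) = real a - real_of_int (j p) * real d) \<and>
    (\<Sum>p\<in>{p\<in>{..<k}. st p \<in> S}. real_of_int (j p)) = 2 * real a"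
proof -
  define s where "s = 3*d*b + a - d"
  have "d * b \<ge> d * 1" using assms(3) by (intro mult_left_mono) auto
  moreover have "3*d*b = 3 * (d * b)" by simp
  \<comment> \<open>The second inequality is strict because a \<ge> 1; for b = 1 and a = 0 equality
    would hold.\<close>
  ultimately have m: "3*d*b + a = s + d" and sd: "s > 2 * d" using assms(4) unfolding s_def by linarith+
  have rs: "real s = 3 * real d * real b + real a - real d"
    using arg_cong[OF m, of real] by simp
  have spos: "real s > 0" using sd by simp
  have fc: "fc_proc (s + d) s k mu st sz" using assms(1) unfolding s_def[symmetric] unfolding m .
  obtain S \<tau> \<kappa> where S: "S \<subseteq> {..<s}" "card S = 2 * d" "pairing {p\<in>{..<k}. st p \<in> S} \<tau>"
    and S3: "\<And>v. v \<in> S \<Longrightarrow> card {p. p < k \<and> st p = v} = 3"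
    and \<kappa>: "\<And>p. p \<in> {p\<in>{..<k}. st p \<in> S} \<Longrightarrow> sz p + sz (\<tau> p) = 1 - real (\<kappa> p) * (real d / real s)"
    and sum\<kappa>: "(\<Sum>p\<in>{p\<in>{..<k}. st p \<in> S}. real (\<kappa> p)) = 2 * (real s - 2 * real d)"
    using fc_proc_chains[OF fc assms(2) sd] by blast
  define H where "H = {p\<in>{..<k}. st p \<in> S}"
  define j where "j p = int (\<kappa> p) - (int b - 1)" for p
  have u: "u p = real s * sz p - real d * real b" for p by (simp add: u_def s_def)
  have 1: "u p + u (\<tau> p) = real a - real_of_int (j p) * real d" if "p \<in> H" for p
  proof -
    have "real s * sz p + real s * sz (\<tau> p) = real s - real (\<kappa> p) * real d"
      unfolding distrib_left[symmetric]
      unfolding \<kappa>[OF that[unfolded H_def]] using spos by (simp add: right_diff_distrib)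
    moreover have "real_of_int (j p) * real d = real (\<kappa> p) * real d - real d * real b + real d"
      by (simp add: j_def algebra_simps)
    ultimately show ?thesis unfolding u using rs by linarith
  qed
  have 2: "(\<Sum>p\<in>{p. p < k \<and> st p = v}. u p) = real a" if "v \<in> S" for v
  proof -
    have "(\<Sum>p\<in>{p. p < k \<and> st p = v}. sz p) = real (s + d) / real s"
      using fc S(1) that by (auto simp: fc_proc_def muffin_proc_def)
    then have "(\<Sum>p\<in>{p. p < k \<and> st p = v}. u p) = real s * (real (s + d) / real s) - 3 * (real d * real b)"
      unfolding u using S3[OF that] by (simp add: sum_subtractf flip: sum_distrib_left)
    then show ?thesis using spos rs by simp
  qed
  have cardH: "card H = 6 * d"
  proof -
    have fib: "{p\<in>H. st p = v} = {p. p < k \<and> st p = v}" if "v \<in> S" for v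
      using that by (auto simp: H_def)
    have "card H = (\<Sum>v\<in>S. card {p\<in>H. st p = v})"
      by (rule card_eq_sum_fibres) (use S(1) finite_subset in \<open>auto simp: H_def\<close>)
    then show ?thesis using S(2) by (simp add: fib S3)
  qed
  have "(\<Sum>p\<in>H. real_of_int (j p)) = (\<Sum>p\<in>H. real (\<kappa> p)) - real (card H) * (real b - 1)"
    by (simp add: j_def sum_subtractf)
  also have "\<dots> = 2 * real a" using sum\<kappa>[folded H_def] cardH rs by (simp add: algebra_simps)
  finally have 3: "(\<Sum>p\<in>H. real_of_int (j p)) = 2 * real a" .
  show ?thesis
    using S S3 1 2 3 finite_subset[OF S(1)] unfolding H_def
    by (intro exI[of _ S] exI[of _ \<tau>] exI[of _ j] conjI ballI) blast+
qed

text \<open>The values \<open>j\<close> have a positive sum, so some chain has j \<ge> 1. Its two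
  ends total at most a - d, and the smaller one is at most half of that.\<close>

lemma fc_proc_smallest_le_half:
  assumes "fc_proc (3*d*b + a) (3*d*b + a - d) k mu st sz" "d \<ge> 1" "b \<ge> 1" "a \<ge> 1"
  shows "real (3*d*b + a - d) * smallest_piece k sz - real d * real b \<le> (real a - real d) / 2"
proof -
  define R where "R = real (3*d*b + a - d)"
  let ?u = "\<lambda>p. real (3*d*b + a - d) * sz p - real d * real b"
  obtain S \<tau> j where S: "pairing {p\<in>{..<k}. st p \<in> S} \<tau>"
    and u: "\<forall>p\<in>{p\<in>{..<k}. st p \<in> S}. ?u p + ?u (\<tau> p) = real a - real_of_int (j p) * real d"
    and sum: "(\<Sum>p\<in>{p\<in>{..<k}. st p \<in> S}. real_of_int (j p)) = 2 * real a"
    using fc_proc_scaled[OF assms] by (elim exE conjE) (rule that)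
  have "\<exists>p\<in>{p\<in>{..<k}. st p \<in> S}. j p \<ge> 1"
  proof (rule ccontr)
    assume "\<not> ?thesis"
    then have "(\<Sum>p\<in>{p\<in>{..<k}. st p \<in> S}. real_of_int (j p)) \<le> 0" by (intro sum_nonpos) force
    then show False using sum assms(4) by simp
  qed
  then obtain p where p: "p < k" "st p \<in> S" "j p \<ge> 1" by auto
  have q: "\<tau> p < k" using S p by (auto simp: pairing_def)
  have "1 * real d \<le> real_of_int (j p) * real d" using p(3) by (intro mult_right_mono) auto
  then have "real (3*d*b + a - d) * (sz p + sz (\<tau> p)) - 2 * (real d * real b) \<le> real a - real d"
    using bspec[OF u, of p] p by (simp add: algebra_simps)
  moreover have "real (3*d*b + a - d) * (2 * smallest_piece k sz) \<le> real (3*d*b + a - d) * (sz p + sz (\<tau> p))"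
    using smallest_piece_le[OF p(1), of sz] smallest_piece_le[OF q, of sz] by (intro mult_left_mono) auto
  ultimately show ?thesis unfolding R_def[symmetric] by (simp add: algebra_simps)
qed

text \<open>A violating procedure has scaled minimum \<mu> > e / 3. This forces every
  \<open>j\<close> to be 0 or 1, merging removes the chains with j = 0, and division by e makes the
  rest a halved procedure for a muffins and a - d students with all pieces at least \<mu> / e > f(a,
  a - d).\<close>

lemma fc_proc_smallest_le_muffin_f:
  assumes "fc_proc (3*d*b + a) (3*d*b + a - d) k mu st sz" "d \<ge> 1" "b \<ge> 1" "d < a" "a < 3 * d"
    and third: "muffin_f a (a - d) \<ge> 1 / 3"
  shows "real (3*d*b + a - d) * smallest_piece k sz - real d * real b
    \<le> (real a - real d) * muffin_f a (a - d)"
proof (rule ccontr)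
  assume neg: "\<not> ?thesis"
  define u where "u p = real (3*d*b + a - d) * sz p - real d * real b" for p
  define \<mu> where "\<mu> = real (3*d*b + a - d) * smallest_piece k sz - real d * real b"
  define e where "e = real a - real d"
  have a1: "a \<ge> 1" and e: "e > 0" "real (a - d) = e" using assms(4) by (auto simp: e_def)
  have \<mu>f: "\<mu> > e * muffin_f a (a - d)" using neg by (simp add: \<mu>_def e_def)
  have "e * (1 / 3) \<le> e * muffin_f a (a - d)" using third e(1) by (intro mult_left_mono) auto
  then have \<mu>: "\<mu> > e / 3" using \<mu>f by simp
  obtain S \<tau> j where S: "finite S" "card S = 2 * d" "pairing {p\<in>{..<k}. st p \<in> S} \<tau>"
    and S3a: "\<forall>v\<in>S. card {p. p < k \<and> st p = v} = 3 \<and> (\<Sum>p\<in>{p. p < k \<and> st p = v}. u p) = real a"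
    and uub: "\<forall>p\<in>{p\<in>{..<k}. st p \<in> S}. u p + u (\<tau> p) = real a - real_of_int (j p) * real d"
    and sumj: "(\<Sum>p\<in>{p\<in>{..<k}. st p \<in> S}. real_of_int (j p)) = 2 * real a"
    using fc_proc_scaled[OF assms(1-3) a1] unfolding u_def[symmetric] by (elim exE conjE) (rule that)
  have S3: "card {p. p < k \<and> st p = v} = 3" and Sa: "(\<Sum>p\<in>{p. p < k \<and> st p = v}. u p) = real a"
    if "v \<in> S" for v using S3a that by auto
  have uu: "u p + u (\<tau> p) = real a - real_of_int (j p) * real d" if "p < k" "st p \<in> S" for p
    using uub that by auto
  define H where "H = {p\<in>{..<k}. st p \<in> S}"
  have finH: "finite H" by (simp add: H_def)
  have u\<mu>: "u p \<ge> \<mu>" if "p < k" for p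
    unfolding u_def \<mu>_def using smallest_piece_le[OF that, of sz] by (simp add: mult_left_mono)
  have fib: "{p\<in>H. st p = v} = {p. p < k \<and> st p = v}" if "v \<in> S" for v
    using that by (auto simp: H_def)
  have \<tau>H: "pairing H \<tau>" using S(3) by (simp add: H_def)
  have upper: "u p \<le> real a - 2 * \<mu>" if p: "p \<in> H" for p
  proof -
    let ?F = "{q. q < k \<and> st q = st p}"
    have "st p \<in> S" "p \<in> ?F" using p by (auto simp: H_def)
    then have "real a = u p + sum u (?F - {p})"
      using Sa[of "st p"] sum.remove[of ?F p u] by simp
    moreover have "real (card (?F - {p})) * \<mu> \<le> sum u (?F - {p})"
      by (rule sum_bounded_below) (use u\<mu> in auto)
    moreover have "card (?F - {p}) = 2" using S3[OF \<open>st p \<in> S\<close>] \<open>p \<in> ?F\<close> by simp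
    ultimately show ?thesis by simp
  qed
  \<comment> \<open>If j \<ge> 2, then 2 * \<mu> \<le> a - 2 * d, which together with \<mu> > e / 3
    gives a > 4 * d. If j \<le> -1, then a + d \<le> 2 * (a - 2 * \<mu>), that is, 4 * \<mu> \<le>
    e.\<close>
  have j01: "j p = 0 \<or> j p = 1" if p: "p \<in> H" for p
  proof -
    have q: "\<tau> p \<in> H" using \<tau>H p by (auto simp: pairing_def)
    have eq: "u p + u (\<tau> p) = real a - real_of_int (j p) * real d" using uu p by (simp add: H_def)
    have "\<not> j p \<ge> 2"
    proof
      define J where "J = real_of_int (j p) * real d"
      assume "j p \<ge> 2"
      then have "2 * real d \<le> J" unfolding J_def by (intro mult_right_mono) auto
      moreover have "u p \<ge> \<mu>" "u (\<tau> p) \<ge> \<mu>" using u\<mu> p q by (auto simp: H_def)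
      moreover have "real a < 3 * real d" "real d \<ge> 1" using assms(2,5) by simp_all
      moreover have "real a - real d < 3 * \<mu>" using \<mu> by (simp add: e_def)
      ultimately show False using eq[folded J_def] by linarith
    qed
    moreover have "\<not> j p \<le> -1"
    proof
      assume "j p \<le> -1"
      then have "real_of_int (j p) * real d \<le> (-1) * real d" by (intro mult_right_mono) auto
      then show False using eq \<mu> upper[OF p] upper[OF q] assms(4) by (simp add: e_def)
    qed
    ultimately show ?thesis by linarith
  qed
  have ae: "real a \<noteq> e" using assms(2) by (simp add: e_def)
  have dich: "u p > 0 \<and> (u p + u (\<tau> p) = real a \<or> u p + u (\<tau> p) = e)" if "p \<in> H" for p
    using j01[OF that] uu[of p] u\<mu>[of p] that \<mu> e by (auto simp: H_def e_def)
  define H1 where "H1 = {p\<in>H. u p + u (\<tau> p) = e}"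
  have "\<exists>(S' :: nat set) c'. finite S' \<and> c' ` {p\<in>H. u p + u (\<tau> p) = e} \<subseteq> S' \<and>
    pairing {p\<in>H. u p + u (\<tau> p) = e} \<tau> \<and>
    (\<forall>v\<in>S'. (\<Sum>p\<in>{p\<in>{p\<in>H. u p + u (\<tau> p) = e}. c' p = v}. u p) = real a)"
  proof (rule merge_classes[where c = st and u = u, OF ae finH S(1) _ \<tau>H])
    show "st ` H \<subseteq> S" by (auto simp: H_def)
    show "3 \<le> card {p\<in>H. st p = v} \<and> (\<Sum>p\<in>{p\<in>H. st p = v}. u p) = real a" if "v \<in> S" for v
      using S3[OF that] Sa[OF that] fib[OF that] by simp
  qed (rule dich)
  then obtain S' :: "nat set" and c' where S': "finite S'" "c' ` H1 \<subseteq> S'" "pairing H1 \<tau>"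
    and S'a: "\<And>v. v \<in> S' \<Longrightarrow> (\<Sum>p\<in>{p\<in>H1. c' p = v}. u p) = real a"
    unfolding H1_def by blast
  have finH1: "finite H1" using finH by (simp add: H1_def)
  \<comment> \<open>On \<open>H\<close>, j is the indicator of \<open>H1\<close>, so its total 2 * a
    is the number of surviving pieces.\<close>
  have j_eq: "j p = (if p \<in> H1 then 1 else 0)" if "p \<in> H" for p
    using j01[OF that] uu[of p] that assms(2) by (auto simp: H1_def H_def e_def)
  have "(\<Sum>p\<in>H. real_of_int (j p)) = (\<Sum>p\<in>H. if p \<in> H1 then 1 else 0)"
    by (rule sum.cong) (auto simp: j_eq)
  also have "\<dots> = real (card H1)"
    using finH by (simp add: sum.If_cases Int_absorb1 H1_def Collect_conj_eq flip: sum.inter_filter)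
  finally have cardH1: "card H1 = 2 * a" using sumj by (simp add: H_def)
  \<comment> \<open>The a surviving pairs have total e each and every class has total a, so there
    are e = a - d classes.\<close>
  have "(\<Sum>p\<in>H1. u p + u (\<tau> p)) = real (card H1) * e" by (simp add: H1_def)
  then have "sum u H1 = real a * e" using cardH1 by (simp add: sum.distrib pairing_sum[OF S'(3)])
  moreover have "sum u H1 = (\<Sum>v\<in>S'. \<Sum>p\<in>{p\<in>H1. c' p = v}. u p)"
    by (rule sum.group[symmetric]) (use finH1 S' in auto)
  ultimately have "real (card S') * real a = e * real a" by (simp add: S'a)
  then have "real (card S') = real (a - d)" using a1 e by simp
  then have cardS': "card S' = a - d" by (simp only: of_nat_eq_iff)
  define f where "f p = u p / e" for p
  obtain X where X: "image_mset f (mset_set H1) = X + image_mset (\<lambda>x. 1 - x) X"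
    using pairing_mset[OF finH1 S'(3), of f "\<lambda>x. 1 - x"] e(1)
    by (auto simp: f_def H1_def field_simps)
  let ?\<D> = "image_mset (\<lambda>v. image_mset f (mset_set {p\<in>H1. c' p = v})) (mset_set S')"
  have "sum_mset ?\<D> = X + image_mset (\<lambda>x. 1 - x) X"
    using image_mset_conv_sum_fibres[OF finH1 S'(1,2), of f] X by (simp add: sum_unfold_sum_mset)
  moreover have "size X = a"
    using arg_cong[OF X, of size] cardH1 by simp
  moreover have "sum f {p\<in>H1. c' p = v} = real a / real (a - d)" if "v \<in> S'" for v
    using S'a[OF that] e(2) by (simp add: f_def flip: sum_divide_distrib)
  moreover have "f p \<ge> \<mu> / e" if "p \<in> H1" for p
    using u\<mu>[of p] that e(1) by (auto simp: f_def H1_def H_def divide_right_mono)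
  ultimately have "halved a (a - d) (\<mu> / e) ?\<D>"
    using S'(1) finH1 cardS' unfolding halved_def by (auto simp flip: sum_unfold_sum_mset)
  from halved_le_muffin_f[OF this] have "\<mu> / e \<le> muffin_f a (a - d)" using \<mu> e a1 by simp
  then show False using \<mu>f e(1) by (simp add: field_simps)
qed

subsection \<open>Building fully-constrained procedures\<close>

text \<open>
  A label (u, j) stands for the end piece of scaled size u of a chain through b - 1 + j two-piece
  students.
\<close>

definition end_partner :: "nat \<Rightarrow> nat \<Rightarrow> real \<times> nat \<Rightarrow> real \<times> nat" where
  "end_partner a d l = (real a - real (snd l) * real d - fst l, snd l)"

definition cubic_conf :: "nat \<Rightarrow> nat \<Rightarrow> real \<Rightarrow> (real \<times> nat) multiset multiset \<Rightarrow> (real \<times> nat) multiset \<Rightarrow> bool" where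
  "cubic_conf a d \<mu> \<D> X \<longleftrightarrow> sum_mset \<D> = X + image_mset (end_partner a d) X \<and>
     (\<forall>D\<in>#\<D>. sum_mset (image_mset fst D) = real a \<and> 3 \<le> size D \<and> (\<forall>l\<in>#D. \<mu> \<le> fst l)) \<and>
     sum_mset (image_mset snd X) = a"

section \<open>Sums and images of multisets\<close>

lemma image_mset_sum_mset: "image_mset f (sum_mset M) = sum_mset (image_mset (image_mset f) M)"
  by (induction M) auto

lemma image_mset_sum: "finite A \<Longrightarrow> image_mset f (\<Sum>x\<in>A. M x) = (\<Sum>x\<in>A. image_mset f (M x))"
  by (induction A rule: finite_induct) auto

lemma size_sum_mset: "size (sum_mset M) = sum_mset (image_mset size M)" for M :: "'a multiset multiset"
  by (induction M) auto

lemma sum_mset_sum_mset: "sum_mset (sum_mset M) = sum_mset (image_mset sum_mset M)"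
  for M :: "'b::comm_monoid_add multiset multiset"
  by (induction M) auto

lemma sum_mset_image_const: "(\<And>x. x \<in># M \<Longrightarrow> f x = c) \<Longrightarrow> sum_mset (image_mset f M) = size M * c"
  for c :: nat
  by (induction M) auto

lemma sum_mset_sum: "finite A \<Longrightarrow> sum_mset (\<Sum>x\<in>A. M x) = (\<Sum>x\<in>A. sum_mset (M x))"
  for M :: "'a \<Rightarrow> 'b::comm_monoid_add multiset"
  by (induction A rule: finite_induct) auto

lemma sum_mset_bounded_below:
  fixes f :: "'a \<Rightarrow> real"
  shows "(\<And>x. x \<in># M \<Longrightarrow> c \<le> f x) \<Longrightarrow> real (size M) * c \<le> sum_mset (image_mset f M)"
  by (induction M) (auto simp: algebra_simps add_mono)

text \<open>A chain of K students runs through K + 1 muffins with pieces f i and h i; student i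
  holds h i and f (i + 1), and f 0 and h K are the end pieces. The two sides list all pieces by
  students and by muffins.\<close>

lemma chain_mset_identity:
  fixes f h :: "nat \<Rightarrow> 'a"
  shows "{#f 0#} + {#h K#} + (\<Sum>i<K. {#h i, f (Suc i)#}) = (\<Sum>i<Suc K. {#f i#}) + (\<Sum>i<Suc K. {#h i#})"
proof -
  have "(\<Sum>i<Suc K. {#f i#}) = {#f 0#} + (\<Sum>i<K. {#f (Suc i)#})"
    by (rule sum.lessThan_Suc_shift)
  moreover have "(\<Sum>i<K. {#h i, f (Suc i)#}) = (\<Sum>i<K. {#h i#}) + (\<Sum>i<K. {#f (Suc i)#})"
    by (simp add: add_mset_commute flip: sum.distrib)
  ultimately show ?thesis by simp
qed

text \<open>Every label of \<open>X\<close> is expanded into a chain of b - 1 + j two-piece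
  students, with the cut shifted by \<delta> at each student. An inner piece is at least as large as
  one of the two end pieces of its chain, so the minimum is controlled by the labels.\<close>

lemma fc_proc_of_cubic_conf:
  assumes conf: "cubic_conf a d \<mu> \<D> X" and three: "\<And>D. D \<in># \<D> \<Longrightarrow> size D = 3"
    and size\<D>: "size \<D> = 2 * d" and "d \<ge> 1" "b \<ge> 1" and pos: "real d * real b + \<mu> > 0"
  shows "\<exists>k mu st sz. fc_proc (3*d*b + a) (3*d*b + a - d) k mu st sz \<and>
    (\<forall>p<k. (real d * real b + \<mu>) / real (3*d*b + a - d) \<le> sz p)"
proof -
  obtain b' where b': "b = Suc b'" using assms(5) by (cases b) auto
  define s where "s = 3*d*b + a - d"
  define m where "m = 3*d*b + a"
  define t where "t = (real d * real b + \<mu>) / real s"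
  have s: "s = 3 * d * b' + 2 * d + a" and ms: "m = s + d" by (simp_all add: s_def m_def b')
  have "s > 0" using s assms(4) by simp
  then have spos: "real s > 0" by simp
  have rs: "real s = 3 * real d * real b + real a - real d" using s b' by (simp add: algebra_simps)
  have rm: "real m = 3 * real d * real b + real a" using m_def by simp
  define \<delta> where "\<delta> = real d / real s"
  have \<delta>: "\<delta> \<ge> 0" and m_s: "real m / real s = 1 + \<delta>" using ms spos by (simp_all add: \<delta>_def field_simps)
  \<comment> \<open>Undoes the scaling u = s * size - d * b.\<close>
  define g where "g u = (u + real d * real b) / real s" for u
  define K where "K l = b' + snd l" for l :: "real \<times> nat"
  define chain :: "real \<times> nat \<Rightarrow> real multiset multiset" where
    "chain l = (\<Sum>i<K l. {#{#1 - (g (fst l) + real i * \<delta>), g (fst l) + real (Suc i) * \<delta>#}#})" for l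
  define \<C> where "\<C> = sum_mset (image_mset chain X)"
  define \<D>' where "\<D>' = image_mset (image_mset (\<lambda>l. g (fst l))) \<D> + \<C>"
  define Y where "Y l = (\<Sum>i<Suc (K l). {#g (fst l) + real i * \<delta>#})" for l
  define X' where "X' = sum_mset (image_mset Y X)"
  have sumD: "sum_mset \<D> = X + image_mset (end_partner a d) X"
    and D: "\<And>D. D \<in># \<D> \<Longrightarrow> sum_mset (image_mset fst D) = real a"
    and D\<mu>: "\<And>D l. D \<in># \<D> \<Longrightarrow> l \<in># D \<Longrightarrow> \<mu> \<le> fst l"
    and sndX: "sum_mset (image_mset snd X) = a"
    using conf by (auto simp: cubic_conf_def)
  have X\<mu>: "\<mu> \<le> fst l" "\<mu> \<le> fst (end_partner a d l)" if "l \<in># X" for l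
  proof -
    have "l \<in># sum_mset \<D>" "end_partner a d l \<in># sum_mset \<D>" using that by (auto simp: sumD)
    then show "\<mu> \<le> fst l" "\<mu> \<le> fst (end_partner a d l)" using D\<mu> by (meson in_Union_mset_iff)+
  qed
  have g_partner: "g (fst (end_partner a d l)) = 1 - (g (fst l) + real (K l) * \<delta>)" for l
  proof -
    have "1 - (g (fst l) + real (K l) * \<delta>) = (real s - (fst l + real d * real b) - real (K l) * real d) / real s"
      using spos by (simp add: g_def \<delta>_def diff_divide_distrib add_divide_distrib)
    moreover have "real s - (fst l + real d * real b) - real (K l) * real d
        = fst (end_partner a d l) + real d * real b"
      unfolding rs by (simp add: end_partner_def K_def b' algebra_simps)
    ultimately show ?thesis by (simp add: g_def)
  qed
  have sizeX: "size X = 3 * d"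
    using arg_cong[OF sumD, of size] sum_mset_image_const[of \<D> size 3] three size\<D>
    by (simp add: size_sum_mset)
  have chain_sum: "{#g (fst l)#} + {#g (fst (end_partner a d l))#} + sum_mset (chain l)
      = Y l + image_mset (\<lambda>x. 1 - x) (Y l)" for l
    using chain_mset_identity[of "\<lambda>i. g (fst l) + real i * \<delta>" "\<lambda>i. 1 - (g (fst l) + real i * \<delta>)" "K l"]
    unfolding g_partner chain_def Y_def
    by (simp add: sum_mset_sum image_mset_sum del: sum.lessThan_Suc)
  have "sum_mset \<D>' = image_mset (\<lambda>l. g (fst l)) (sum_mset \<D>) + sum_mset (image_mset (\<lambda>l. sum_mset (chain l)) X)"
    by (simp add: \<D>'_def \<C>_def image_mset_sum_mset sum_mset_sum_mset multiset.map_comp o_def)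
  also have "\<dots> = sum_mset (image_mset (\<lambda>l. {#g (fst l)#} + {#g (fst (end_partner a d l))#} + sum_mset (chain l)) X)"
    unfolding sumD by (induction X) (auto simp: ac_simps)
  also have "\<dots> = X' + image_mset (\<lambda>x. 1 - x) X'"
    unfolding chain_sum X'_def by (induction X) (auto simp: ac_simps)
  finally have sum\<D>': "sum_mset \<D>' = X' + image_mset (\<lambda>x. 1 - x) X'" .
  have size\<C>: "size \<C> = 3 * d * b' + a"
    using sizeX sndX unfolding \<C>_def
    by (simp add: size_sum_mset multiset.map_comp o_def chain_def K_def sum_mset.distrib)
  have sizeX': "size X' = m"
    using sizeX sndX unfolding X'_def m_def b'
    by (simp add: size_sum_mset multiset.map_comp o_def Y_def K_def sum_mset.distrib flip: add_Suc)
  have cls: "sum_mset E = 1 + \<delta> \<and> (\<forall>x\<in>#E. t \<le> x) \<and> (size E = 2 \<or> size E = 3) \<and> (size E = 2 \<longrightarrow> E \<in># \<C>)"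
    if E: "E \<in># \<D>'" for E
  proof -
    have gt: "t \<le> g u" if "\<mu> \<le> u" for u
      unfolding t_def g_def using that spos by (intro divide_right_mono) auto
    consider D where "D \<in># \<D>" "E = image_mset (\<lambda>l. g (fst l)) D" | "E \<in># \<C>"
      using E by (auto simp: \<D>'_def)
    then show ?thesis
    proof cases
      case 1
      have "sum_mset (image_mset (\<lambda>l. g (fst l)) D)
          = (sum_mset (image_mset fst D) + real (size D) * (real d * real b)) / real s"
        unfolding g_def by (induction D) (auto simp: add_divide_distrib distrib_right)
      also have "\<dots> = 1 + \<delta>" using D[OF 1(1)] three[OF 1(1)] rm m_s by (simp add: algebra_simps)
      finally show ?thesis using 1 three[OF 1(1)] gt D\<mu>[OF 1(1)] by auto
    next
      case 2
      then obtain l where l: "l \<in># X" "E \<in># chain l" by (auto simp: \<C>_def)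
      then obtain i where i: "i < K l" "E = {#1 - (g (fst l) + real i * \<delta>), g (fst l) + real (Suc i) * \<delta>#}"
        by (auto simp: chain_def set_mset_sum)
      have "g (fst l) \<le> g (fst l) + real (Suc i) * \<delta>" using \<delta> by simp
      moreover have "real i * \<delta> \<le> real (K l) * \<delta>" using \<delta> i(1) by (intro mult_right_mono) auto
      then have "g (fst (end_partner a d l)) \<le> 1 - (g (fst l) + real i * \<delta>)"
        unfolding g_partner by simp
      ultimately show ?thesis using i(2) 2 gt[OF X\<mu>(1)[OF l(1)]] gt[OF X\<mu>(2)[OF l(1)]]
        by (auto simp: algebra_simps)
    qed
  qed
  have halved: "halved m s t \<D>'"
    unfolding halved_def m_s
    using cls sum\<D>' sizeX' size\<C> size\<D> s by (auto simp: \<D>'_def)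
  have tpos: "t > 0" using pos spos by (simp add: t_def)
  obtain st sz where proc: "muffin_proc m s (2*m) (\<lambda>p. p div 2) st sz" "\<forall>p<2*m. t \<le> sz p"
    and fib: "\<forall>j<s. \<exists>E\<in>#\<D>'. card {p. p < 2*m \<and> st p = j} = size E"
    by (rule proc_of_halved[OF halved tpos]) (rule that)
  have "size E \<in> {(2*m) div s, (2*m) div s + 1}" if E: "E \<in># \<D>'" for E
  proof (cases "s > 2 * d")
    case True
    then have "(2*m) div s = 2" using ms by (intro div_nat_eqI) auto
    then show ?thesis using cls[OF E] by auto
  next
    case False
    \<comment> \<open>Only b = 1 and a = 0 remain. There are no two-piece students then, and the
      quotient of 2 * m by s jumps to 3.\<close>
    then have "\<C> = {#}" and sd: "s = 2 * d" using s size\<C> by auto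
    then have "size E = 3" using cls[OF E] by auto
    moreover have "(2*m) div s = 3" using ms sd assms(4) by simp
    ultimately show ?thesis by simp
  qed
  then have "fc_proc m s (2*m) (\<lambda>p. p div 2) st sz"
    unfolding fc_proc_def using proc(1) fib by (auto simp: pair_fibre) metis+
  then show ?thesis using proc(2) unfolding t_def m_def s_def by blast
qed

text \<open>
  The inverse of merging: a class of at least four labels sheds two of them, and both parts are
  joined by a new chain with j = 0.
\<close>

lemma split_classes:
  assumes "cubic_conf a d \<mu> \<D> X" "\<mu> \<ge> 0" "size X = size \<D> + d"
  shows "\<exists>\<D>' X'. cubic_conf a d \<mu> \<D>' X' \<and> (\<forall>D\<in>#\<D>'. size D = 3) \<and> size \<D>' = 2 * d"
  using assms
proof (induction "2 * size X - 3 * size \<D>" arbitrary: \<D> X rule: less_induct)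
  case less
  have sumD: "sum_mset \<D> = X + image_mset (end_partner a d) X"
    and D: "\<And>D. D \<in># \<D> \<Longrightarrow> sum_mset (image_mset fst D) = real a \<and> 3 \<le> size D \<and> (\<forall>l\<in>#D. \<mu> \<le> fst l)"
    and sndX: "sum_mset (image_mset snd X) = a"
    using less.prems(1) unfolding cubic_conf_def by auto
  have total: "sum_mset (image_mset size \<D>) = 2 * size X"
    using arg_cong[OF sumD, of size] by (simp add: size_sum_mset)
  show ?case
  proof (cases "\<forall>D\<in>#\<D>. size D = 3")
    case True
    then have "3 * size \<D> = 2 * size X" using total sum_mset_image_const[of \<D> size 3] by simp
    then have "size \<D> = 2 * d" using less.prems(3) by simp
    then show ?thesis using True less.prems(1) by blast
  next
    case False
    then obtain D0 where D0: "D0 \<in># \<D>" "size D0 \<noteq> 3" by blast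
    then have "size D0 = Suc (Suc (size D0 - 2))" "size D0 \<ge> 4" using D[OF D0(1)] by auto
    then obtain p q R where pqR: "D0 = add_mset p (add_mset q R)"
      by (metis size_eq_Suc_imp_eq_union Suc_inject size_add_mset)
    obtain \<E> where \<E>: "\<D> = add_mset D0 \<E>" using D0(1) by (metis mset_add)
    \<comment> \<open>\<open>x\<close> completes p and q to a triple of total a, and it is also the
      total of \<open>R\<close>. Its partner a - x is the sum of p and q, which completes
      \<open>R\<close>.\<close>
    define x where "x = real a - fst p - fst q"
    define \<D>1 where "\<D>1 = add_mset {#p, q, (x, 0)#} (add_mset (add_mset (fst p + fst q, 0) R) \<E>)"
    define X1 where "X1 = add_mset (x, 0) X"
    have R: "sum_mset (image_mset fst R) = x" "size R \<ge> 2" "\<forall>l\<in>#R. \<mu> \<le> fst l" "\<mu> \<le> fst p" "\<mu> \<le> fst q"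
      using D[OF D0(1)] pqR \<open>size D0 \<ge> 4\<close> by (auto simp: x_def)
    \<comment> \<open>As \<mu> is nonnegative, a sum of several labels still respects the bound;
      this covers both new ends.\<close>
    have "real 1 * \<mu> \<le> real (size R) * \<mu>" using R(2) less.prems(2) by (intro mult_right_mono) auto
    also have "\<dots> \<le> x" using sum_mset_bounded_below[of R \<mu> fst] R by auto
    finally have x\<mu>: "\<mu> \<le> x" by simp
    have "sum_mset \<D>1 = X1 + image_mset (end_partner a d) X1"
      using sumD unfolding \<D>1_def X1_def \<E> pqR by (simp add: end_partner_def x_def add_mset_commute)
    moreover have "sum_mset (image_mset fst D) = real a \<and> 3 \<le> size D \<and> (\<forall>l\<in>#D. \<mu> \<le> fst l)"
      if "D \<in># \<D>1" for D
      using that D R x\<mu> less.prems(2) by (auto simp: \<D>1_def \<E> x_def)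
    ultimately have conf1: "cubic_conf a d \<mu> \<D>1 X1"
      using sndX unfolding cubic_conf_def by (simp add: X1_def)
    have size1: "size X1 = Suc (size X)" "size \<D>1 = Suc (size \<D>)" by (simp_all add: X1_def \<D>1_def \<E>)
    \<comment> \<open>The measure changes by 2 - 3 = -1. It is a truncated difference, so it must be
      positive beforehand in order to drop.\<close>
    have "3 * size \<D> < 2 * size X"
    proof -
      have "real (size \<E>) * 3 \<le> sum_mset (image_mset (\<lambda>D. real (size D)) \<E>)"
        using D by (intro sum_mset_bounded_below) (force simp: \<E>)
      also have "\<dots> = real (sum_mset (image_mset size \<E>))" by (induction \<E>) auto
      finally have "3 * size \<E> \<le> sum_mset (image_mset size \<E>)" by linarith
      then show ?thesis using total \<open>size D0 \<ge> 4\<close> by (simp add: \<E>)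
    qed
    then show ?thesis using less.hyps[OF _ conf1 less.prems(2)] less.prems(3) size1 by simp
  qed
qed

section \<open>Orderings with bounded partial sums\<close>

lemma greedy_walk:
  fixes f :: "'x \<Rightarrow> real"
  assumes "\<And>c. c \<in># C \<Longrightarrow> - A \<le> f c \<and> f c \<le> U" "- A \<le> x" "x \<le> U"
    and "x + sum_mset (image_mset f C) = 0"
  shows "\<exists>cs. mset cs = C \<and>
    (\<forall>i\<le>length cs. - A \<le> x + sum_list (map f (take i cs)) \<and> x + sum_list (map f (take i cs)) \<le> U)"
  using assms
proof (induction "size C" arbitrary: C x)
  case 0
  then show ?case by auto
next
  case (Suc n)
  \<comment> \<open>A negative step from x > 0 stays above -A, and a nonnegative step from x \<le> 0
    stays below U. The zero total guarantees that a step of the wanted sign is left.\<close>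
  have "\<exists>c. c \<in># C \<and> - A \<le> x + f c \<and> x + f c \<le> U"
  proof (cases "x > 0")
    case True
    have "\<exists>c. c \<in># C \<and> f c < 0"
    proof (rule ccontr)
      assume "\<not> ?thesis"
      then have "real (size C) * 0 \<le> sum_mset (image_mset f C)" by (intro sum_mset_bounded_below) force
      then show False using True Suc.prems(4) by simp
    qed
    then obtain c where "c \<in># C" "f c < 0" by blast
    then show ?thesis using True Suc.prems by (intro exI[of _ c]) force
  next
    case False
    have "\<exists>c. c \<in># C \<and> f c \<ge> 0"
    proof (rule ccontr)
      assume neg: "\<not> ?thesis"
      obtain c C' where C: "C = add_mset c C'" using Suc.hyps(2) by (metis size_eq_Suc_imp_eq_union)
      have "real (size C') * 0 \<le> sum_mset (image_mset (\<lambda>c. - f c) C')"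
        using neg by (intro sum_mset_bounded_below) (force simp: C)
      also have "\<dots> = - sum_mset (image_mset f C')" by (induction C') auto
      finally have "sum_mset (image_mset f C') \<le> 0" by simp
      moreover have "f c < 0" using neg by (auto simp: C)
      ultimately show False using False Suc.prems(4) by (simp add: C)
    qed
    then obtain c where "c \<in># C" "f c \<ge> 0" by blast
    then show ?thesis using False Suc.prems by (intro exI[of _ c]) force
  qed
  then obtain c C' where c: "C = add_mset c C'" "- A \<le> x + f c" "x + f c \<le> U" by (metis mset_add)
  obtain cs where cs: "mset cs = C'"
    "\<forall>i\<le>length cs. - A \<le> (x + f c) + sum_list (map f (take i cs)) \<and> (x + f c) + sum_list (map f (take i cs)) \<le> U"
    using Suc.hyps(1)[of C' "x + f c"] Suc.hyps(2) Suc.prems c by (auto simp: algebra_simps)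
  have "- A \<le> x + sum_list (map f (take i (c # cs))) \<and> x + sum_list (map f (take i (c # cs))) \<le> U"
    if "i \<le> length (c # cs)" for i
    using that cs(2) Suc.prems(2,3) by (cases i) (auto simp: algebra_simps)
  then show ?case using cs(1) c(1) by (intro exI[of _ "c # cs"]) auto
qed

text \<open>A walk started at 0 also ends at 0, so its steps can be placed around a closed cycle of
  students.\<close>

lemma greedy_cycle:
  fixes f :: "'x \<Rightarrow> real"
  assumes "\<And>c. c \<in># C \<Longrightarrow> - A \<le> f c \<and> f c \<le> U" "A \<ge> 0" "U \<ge> 0"
    and "sum_mset (image_mset f C) = 0"
  obtains cs t where "mset cs = C" "t 0 = 0" "t (length cs) = 0"
    "\<And>i. i < length cs \<Longrightarrow> t (Suc i) = t i + f (cs ! i)"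
    "\<And>i. i \<le> length cs \<Longrightarrow> - A \<le> t i \<and> t i \<le> U"
proof -
  obtain cs where cs: "mset cs = C"
    "\<forall>i\<le>length cs. - A \<le> 0 + sum_list (map f (take i cs)) \<and> 0 + sum_list (map f (take i cs)) \<le> U"
    using greedy_walk[of C A f U 0] assms by auto
  define t where "t i = sum_list (map f (take i cs))" for i
  have "t (length cs) = sum_mset (image_mset f C)" unfolding t_def cs(1)[symmetric]
    by (simp flip: mset_map sum_mset_sum_list)
  then show thesis using that[of cs t] cs assms(4) by (auto simp: t_def take_Suc_conv_app_nth)
qed

lemma sum_cyclic_shift:
  fixes h :: "nat \<Rightarrow> 'a::cancel_comm_monoid_add"
  assumes "h N = h 0"
  shows "(\<Sum>i<N. h (Suc i)) = (\<Sum>i<N. h i)"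
proof -
  have "h 0 + (\<Sum>i<N. h (Suc i)) = (\<Sum>i<Suc N. h i)" by (rule sum.lessThan_Suc_shift[symmetric])
  also have "\<dots> = h 0 + (\<Sum>i<N. h i)" using assms by (simp add: add.commute)
  finally show ?thesis by simp
qed

section \<open>Configurations attaining the bound\<close>

lemma sum_mset_replicate: "sum_mset (image_mset f (replicate_mset n x)) = real n * f x"
  for f :: "'a \<Rightarrow> real"
  by (induction n) (auto simp: algebra_simps)

lemma replicate_mset_plus: "replicate_mset (m + n) x = replicate_mset m x + replicate_mset n x"
  by (induction m) auto

lemma sum_mset_replicate_replicate:
  "sum_mset (replicate_mset n (replicate_mset k x)) = replicate_mset (n * k) x"
  by (induction n) (auto simp: replicate_mset_plus)

text \<open>
  The students form a cycle of chains with j = 0, and the third piece of each student is half of a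
  chord: chords with j = 1 have total a - d, the others a. The deviation t of the cycle pieces from
  a / 2 is a walk whose steps are determined by the chords.
\<close>

lemma cubic_conf_low:
  assumes "1 \<le> a" "a \<le> d"
  shows "\<exists>\<D> X. cubic_conf a d ((real a - real d) / 2) \<D> X \<and> (\<forall>D\<in>#\<D>. size D = 3) \<and> size \<D> = 2 * d"
proof -
  define l1 where "l1 = ((real a - real d) / 2, 1::nat)"
  define l0 where "l0 = (real a / 2, 0::nat)"
  \<comment> \<open>Two equal halves per chord: a chords with j = 1 supply the total a of j, and d -
    a chords with j = 0 bring the number of students to 2 * d.\<close>
  define C where "C = replicate_mset (2 * a) l1 + replicate_mset (2 * (d - a)) l0"
  have step: "- (real a / 2) \<le> - fst c \<and> - fst c \<le> (real d - real a) / 2" if "c \<in># C" for c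
    using that assms by (auto simp: C_def l1_def l0_def field_simps split: if_splits)
  have sum0: "sum_mset (image_mset (\<lambda>c. - fst c) C) = 0"
    unfolding C_def image_mset_union sum_mset.union sum_mset_replicate
    using assms by (simp add: l1_def l0_def of_nat_diff diff_divide_distrib algebra_simps)
  have "real a / 2 \<ge> 0" "(real d - real a) / 2 \<ge> 0" using assms by simp_all
  from greedy_cycle[OF step this sum0] obtain cs t where cs: "mset cs = C" and t0: "t 0 = 0" "t (length cs) = 0"
    and tS: "\<And>i. i < length cs \<Longrightarrow> t (Suc i) = t i + - fst (cs ! i)"
    and tb: "\<And>i. i \<le> length cs \<Longrightarrow> - (real a / 2) \<le> t i \<and> t i \<le> (real d - real a) / 2"
    by blast
  have len: "length cs = 2 * d"
    using arg_cong[OF cs, of size] assms by (simp add: C_def)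
  \<comment> \<open>The total of student i is a exactly when t (i + 1) = t i - c for its chord piece
    c. The smallest possible step is -a / 2 and the largest (d - a) / 2, which are also the bounds
    of the walk.\<close>
  define D where "D i = {#(real a / 2 + t (Suc i), 0), (real a / 2 - t i, 0), cs ! i#}" for i
  define \<D> where "\<D> = image_mset D (mset_set {..<2*d})"
  define X where "X = (\<Sum>i<2*d. {#(real a / 2 + t (Suc i), 0::nat)#}) + replicate_mset a l1 + replicate_mset (d - a) l0"
  have fixed: "end_partner a d l1 = l1" "end_partner a d l0 = l0"
    by (auto simp: end_partner_def l1_def l0_def field_simps)
  have dbl: "replicate_mset (2 * n) l = replicate_mset n l + replicate_mset n l" for n :: nat and l :: "real \<times> nat"
    by (simp add: mult_2 replicate_mset_plus)
  have "sum_mset \<D> = (\<Sum>i<2*d. {#(real a / 2 + t (Suc i), 0)#}) + (\<Sum>i<2*d. {#(real a / 2 - t i, 0)#})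
      + (\<Sum>i<2*d. {#cs ! i#})"
    by (simp add: \<D>_def D_def add_mset_commute flip: sum_unfold_sum_mset sum.distrib)
  also have "(\<Sum>i<2*d. {#cs ! i#}) = C"
    using sum_mset_conv_nth[of "map (\<lambda>x. {#x#}) cs", OF refl] cs len by simp
  also have "(\<Sum>i<2*d. {#(real a / 2 - t i, 0::nat)#}) = (\<Sum>i<2*d. {#(real a / 2 - t (Suc i), 0)#})"
    using sum_cyclic_shift[of "\<lambda>i. {#(real a / 2 - t i, 0::nat)#}" "2 * d"] t0 len by simp
  finally have "sum_mset \<D> = X + image_mset (end_partner a d) X"
    by (simp add: X_def C_def dbl image_mset_sum fixed  ) (simp add: end_partner_def)
  moreover have "sum_mset (image_mset fst E) = real a \<and> size E = 3 \<and> (\<forall>l\<in>#E. (real a - real d) / 2 \<le> fst l)"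
    if "E \<in># \<D>" for E
  proof -
    have "E \<in> D ` {..<2*d}" using that by (simp add: \<D>_def)
    then obtain i where i: "i < 2 * d" "E = D i" by blast
    have "cs ! i \<in># C" using i(1) len cs by (metis nth_mem set_mset_mset)
    then have "(real a - real d) / 2 \<le> fst (cs ! i)" by (auto simp: C_def l1_def l0_def split: if_splits)
    moreover have "(real a - real d) / 2 \<le> real a / 2 + t (Suc i)" "(real a - real d) / 2 \<le> real a / 2 - t i"
      using tb[of i] tb[of "Suc i"] i(1) len assms by (auto simp: field_simps)
    ultimately show ?thesis using tS[of i] i len by (auto simp: D_def)
  qed
  moreover have "sum_mset (image_mset snd X) = a"
    by (simp add: X_def image_mset_sum sum_mset_sum l1_def l0_def)
  ultimately show ?thesis by (intro exI[of _ \<D>] exI[of _ X]) (auto simp: cubic_conf_def \<D>_def)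
qed

text \<open>For a = 0 the scaled size 0 is a third of the share m / s: every student gets three
  equal pieces, and all chains have j = 0.\<close>

lemma cubic_conf_zero:
  "\<exists>\<D> X. cubic_conf 0 d 0 \<D> X \<and> (\<forall>D\<in>#\<D>. size D = 3) \<and> size \<D> = 2 * d"
proof -
  let ?\<D> = "replicate_mset (2 * d) (replicate_mset 3 (0::real, 0::nat))"
  let ?X = "replicate_mset (3 * d) (0::real, 0::nat)"
  have "end_partner 0 d (0, 0) = (0, 0)" by (simp add: end_partner_def)
  then have "cubic_conf 0 d 0 ?\<D> ?X"
    by (auto simp: cubic_conf_def sum_mset_replicate sum_mset_replicate_replicate
        simp flip: replicate_mset_plus split: if_splits)
  then show ?thesis by (intro exI[of _ ?\<D>] exI[of _ ?X]) auto
qed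

text \<open>With x its complement 1 - x is a piece too, and that one is at least t.\<close>

lemma halved_le_piece:
  assumes "halved m s t \<D>" "D \<in># \<D>" "x \<in># D"
  shows "x \<le> 1 - t"
proof -
  obtain X where X: "sum_mset \<D> = X + image_mset (\<lambda>x. 1 - x) X" using assms(1) by (auto simp: halved_def)
  have ge: "t \<le> y" if "y \<in># sum_mset \<D>" for y
    using that assms(1) by (auto simp: halved_def in_Union_mset_iff)
  have "x \<in># sum_mset \<D>" using assms(2,3) by (auto simp: in_Union_mset_iff)
  then have "1 - x \<in># sum_mset \<D>" unfolding X by (auto simp: image_iff)
  then show ?thesis using ge by force
qed

text \<open>Scaling by e = a - d turns the a muffins into chains with j = 1. Pieces are at most 2/3,
  while the share a / e exceeds 3/2 because a < 3 * d; so every student has at least three pieces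
  and \<open>split_classes\<close> applies.\<close>

lemma cubic_conf_of_halved:
  assumes h: "halved a (a - d) t \<D>" and "t \<ge> 1 / 3" "d < a" "a < 3 * d"
  shows "\<exists>\<D> X. cubic_conf a d ((real a - real d) * t) \<D> X \<and> (\<forall>D\<in>#\<D>. size D = 3) \<and> size \<D> = 2 * d"
proof -
  define e where "e = real a - real d"
  have e: "e > 0" "real (a - d) = e" using assms(3) by (simp_all add: e_def)
  define g where "g x = (e * x, 1::nat)" for x
  obtain X where X: "size X = a" "sum_mset \<D> = X + image_mset (\<lambda>x. 1 - x) X"
    using h by (auto simp: halved_def)
  define \<D>' where "\<D>' = image_mset (image_mset g) \<D>"
  define X' where "X' = image_mset g X"
  have partner: "end_partner a d (g x) = g (1 - x)" for x
    by (simp add: end_partner_def g_def e_def algebra_simps)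
  have "sum_mset \<D>' = X' + image_mset (end_partner a d) X'"
    unfolding \<D>'_def X'_def image_mset_sum_mset[symmetric] X(2)
    by (simp add: multiset.map_comp o_def partner)
  moreover have "sum_mset (image_mset snd X') = a"
    using X(1) by (simp add: X'_def multiset.map_comp o_def g_def)
  moreover have "sum_mset (image_mset fst E) = real a \<and> 3 \<le> size E \<and> (\<forall>l\<in>#E. e * t \<le> fst l)"
    if E: "E \<in># \<D>'" for E
  proof -
    obtain D where D: "D \<in># \<D>" "E = image_mset g D" using E by (auto simp: \<D>'_def)
    have sumD: "sum_mset D = real a / e" and Dt: "\<forall>x\<in>#D. t \<le> x"
      using h D(1) e(2) by (auto simp: halved_def)
    have "real (size D) * (- 2 / 3) \<le> sum_mset (image_mset (\<lambda>x. - x) D)"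
      by (rule sum_mset_bounded_below) (use halved_le_piece[OF h D(1)] assms(2) in force)
    also have "\<dots> = - sum_mset D" by (induction D) auto
    finally have "real a / e \<le> real (size D) * (2 / 3)" using sumD by simp
    moreover have "3 / 2 < real a / e" using e assms(4) by (simp add: e_def field_simps)
    ultimately have "2 < real (size D)" by simp
    moreover have "sum_mset (image_mset fst E) = e * sum_mset D"
      unfolding D(2) by (induction D) (auto simp: g_def algebra_simps)
    ultimately show ?thesis using D(2) Dt e sumD by (auto simp: g_def)
  qed
  ultimately have "cubic_conf a d (e * t) \<D>' X'" by (auto simp: cubic_conf_def)
  moreover have "size X' = size \<D>' + d" using X(1) h assms(3) by (simp add: X'_def \<D>'_def halved_def)
  ultimately show ?thesis
    using split_classes[of a d "e * t" \<D>' X'] e assms(2) by (simp add: e_def)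
qed

lemma halved_half:
  assumes "s dvd 2 * m" "s \<ge> 1"
  shows "\<exists>\<D>. halved m s (1 / 2) \<D>"
proof -
  obtain k where k: "2 * m = s * k" using assms(1) by blast
  let ?\<D> = "replicate_mset s (replicate_mset k (1 / 2 :: real))"
  have "real k * (1 / 2) = real m / real s" using arg_cong[OF k, of real] assms(2) by (simp add: field_simps)
  moreover have "replicate_mset (s * k) (1 / 2 :: real) = replicate_mset m (1/2) + replicate_mset m (1/2)"
    by (simp add: mult_2 replicate_mset_plus flip: k)
  ultimately have "halved m s (1 / 2) ?\<D>"
    unfolding halved_def sum_mset_replicate_replicate
    by (auto simp: split: if_splits intro!: exI[of _ "replicate_mset m (1/2)"])
  then show ?thesis by blast
qed

subsection \<open>The muffin function is attained and at least one third\<close>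

text \<open>
  The students form a cycle in which neighbours share a muffin, and E lists the other pieces of
  a student.
\<close>

lemma halved_third_of_chords:
  fixes \<E> :: "real multiset multiset"
  assumes "size \<E> = s" "s \<ge> 1" and Y: "sum_mset \<E> = Y + image_mset (\<lambda>x. 1 - x) Y" "size Y + s = m"
    and third: "\<And>E x. E \<in># \<E> \<Longrightarrow> x \<in># E \<Longrightarrow> 1 / 3 \<le> x"
    and AU: "A \<ge> 0" "U \<ge> 0" "A + U = 1 / 3"
    and step: "\<And>E. E \<in># \<E> \<Longrightarrow> real m / real s - 1 - U \<le> sum_mset E \<and> sum_mset E \<le> real m / real s - 1 + A"
  shows "\<exists>\<D>. halved m s (1 / 3) \<D>"
proof -
  define r where "r = real m / real s"
  have "sum_mset (sum_mset \<E>) = sum_mset (image_mset sum_mset \<E>)" by (rule sum_mset_sum_mset)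
  moreover have "sum_mset (Y + image_mset (\<lambda>x. 1 - x) Y) = real (size Y)"
    by (induction Y) auto
  moreover have "sum_mset (image_mset (\<lambda>E. r - 1 - sum_mset E) \<E>) = real (size \<E>) * (r - 1) - sum_mset (image_mset sum_mset \<E>)"
    by (induction \<E>) (auto simp: algebra_simps)
  moreover have "real s * r = real (size Y) + real s"
    using assms(2) by (simp add: r_def flip: Y(2))
  ultimately have "sum_mset (image_mset (\<lambda>E. r - 1 - sum_mset E) \<E>) = 0"
    using assms(1) Y(1) by (simp add: algebra_simps)
  moreover have "- A \<le> r - 1 - sum_mset E \<and> r - 1 - sum_mset E \<le> U" if "E \<in># \<E>" for E
    using step[OF that] by (simp add: r_def)
  ultimately obtain cs t where cs: "mset cs = \<E>" and t0: "t 0 = 0" "t (length cs) = 0"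
    and tS: "\<And>i. i < length cs \<Longrightarrow> t (Suc i) = t i + (r - 1 - sum_mset (cs ! i))"
    and tb: "\<And>i. i \<le> length cs \<Longrightarrow> - A \<le> t i \<and> t i \<le> U"
    using greedy_cycle[of \<E> A "\<lambda>E. r - 1 - sum_mset E" U] AU by blast
  have len: "length cs = s" using arg_cong[OF cs, of size] assms(1) by simp
  \<comment> \<open>With deviations between -A and U and A + U = 1/3, cuts at h + t range exactly
    over 1/3 to 2/3.\<close>
  define h where "h = 1 / 3 + A"
  \<comment> \<open>The muffin between students i and i + 1 is cut at h + t (i + 1): student i takes
    that part and student i + 1 its complement.\<close>
  define D where "D i = {#h + t (Suc i), 1 - (h + t i)#} + cs ! i" for i
  define \<D> where "\<D> = image_mset D (mset_set {..<s})"
  define X where "X = (\<Sum>i<s. {#h + t (Suc i)#}) + Y"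
  have "sum_mset \<D> = (\<Sum>i<s. {#h + t (Suc i)#}) + (\<Sum>i<s. {#1 - (h + t i)#}) + (\<Sum>i<s. cs ! i)"
    by (simp add: \<D>_def D_def add_mset_commute flip: sum_unfold_sum_mset sum.distrib)
  also have "(\<Sum>i<s. cs ! i) = Y + image_mset (\<lambda>x. 1 - x) Y"
    using sum_mset_conv_nth[OF cs] len Y(1) by simp
  also have "(\<Sum>i<s. {#1 - (h + t i)#}) = (\<Sum>i<s. {#1 - (h + t (Suc i))#})"
    using sum_cyclic_shift[of "\<lambda>i. {#1 - (h + t i)#}" s] t0 len by simp
  finally have "sum_mset \<D> = X + image_mset (\<lambda>x. 1 - x) X"
    by (simp add: X_def image_mset_sum)
  moreover have "size X = m" using Y(2) by (simp add: X_def)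
  moreover have "sum_mset E = r \<and> (\<forall>x\<in>#E. 1 / 3 \<le> x)" if "E \<in># \<D>" for E
  proof -
    have "E \<in> D ` {..<s}" using that by (simp add: \<D>_def)
    then obtain i where i: "i < s" "E = D i" by blast
    have "cs ! i \<in># \<E>" using i(1) len cs by (metis nth_mem set_mset_mset)
    then have "\<forall>x\<in>#cs ! i. 1 / 3 \<le> x" using third by blast
    moreover have "1 / 3 \<le> h + t (Suc i)" "1 / 3 \<le> 1 - (h + t i)"
      using tb[of i] tb[of "Suc i"] i(1) len AU by (auto simp: h_def)
    ultimately show ?thesis using tS[of i] i len by (auto simp: D_def)
  qed
  ultimately have "halved m s (1 / 3) \<D>"
    unfolding halved_def r_def[symmetric] by (auto simp: \<D>_def)
  then show ?thesis by blast
qed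

text \<open>
  Students get n or n + 1 pieces. All muffins off the cycle are halved, except that as many
  n-piece students as possible are matched with (n + 1)-piece students through a muffin cut into
  2/3 and 1/3 (E1 and E2). This shrinks the range of steps from 1/2 to 1/3.
\<close>

lemma halved_third:
  assumes "s \<ge> 1" "3 * s \<le> 2 * m"
  shows "\<exists>\<D>. halved m s (1 / 3) \<D>"
proof -
  define n where "n = (2 * m) div s"
  define w where "w = (2 * m) mod s"
  have n3: "n \<ge> 3" using assms by (simp add: n_def less_eq_div_iff_mult_less_eq)
  have mw: "2 * m = n * s + w" "w < s" using assms(1) by (simp_all add: n_def w_def)
  define c where "c = real w / (2 * real s)"
  have spos: "real s > 0" using assms(1) by simp
  have r: "real m / real s = real n / 2 + c"
    using arg_cong[OF mw(1), of real] spos by (simp add: c_def field_simps)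
  have c0: "0 \<le> c" by (simp add: c_def)
  obtain n' where n': "n = n' + 3" using n3 by (metis add.commute le_Suc_ex)
  \<comment> \<open>Two pieces of every student lie on the cycle. This leaves n - 2 = n' + 1 others
    for n pieces and n - 1 = n' + 2 others for n + 1 pieces.\<close>
  define E1 where "E1 = add_mset (2/3) (replicate_mset n' (1/2 :: real))"
  define E2 where "E2 = add_mset (1/3) (replicate_mset (n' + 1) (1/2 :: real))"
  have sumE: "sum_mset E1 = real n / 2 - 1 + 1 / 6" "sum_mset E2 = real n / 2 - 1 + 1 / 3"
    by (simp_all add: E1_def E2_def n' field_simps)
  have ge: "\<forall>x\<in>#E1. 1 / 3 \<le> x" "\<forall>x\<in>#E2. 1 / 3 \<le> x" by (auto simp: E1_def E2_def split: if_splits)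
  have E12: "sum_mset (replicate_mset q E1) + sum_mset (replicate_mset q E2) =
     replicate_mset q (1/3) + replicate_mset q (2/3) + replicate_mset (q * (2 * n' + 1)) (1/2)" for q
    by (induction q) (auto simp: E1_def E2_def replicate_mset_plus mult_2 mult_2_right algebra_simps)
  \<comment> \<open>Common to both cases: q matched pairs of students, p remaining students with k
    halves each, and N halved muffins off the cycle.\<close>
  have build: "\<exists>\<D>. halved m s (1 / 3) \<D>"
    if E3: "E3 = replicate_mset k (1/2 :: real)" and s: "s = 2 * q + p"
      and N: "q * (2 * n' + 1) + p * k = 2 * N" "q + N + s = m"
      and AU: "A \<ge> 0" "U \<ge> 0" "A + U = 1 / 3"
      and b1: "c - U \<le> 1 / 6" "1 / 3 \<le> c + A"
      and b2: "p > 0 \<Longrightarrow> real n / 2 - 1 + c - U \<le> sum_mset E3 \<and> sum_mset E3 \<le> real n / 2 - 1 + c + A"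
    for E3 k q p N and A U :: real
  proof (rule halved_third_of_chords)
    let ?\<E> = "replicate_mset q E1 + replicate_mset q E2 + replicate_mset p E3"
    let ?Y = "replicate_mset q (1/3) + replicate_mset N (1/2 :: real)"
    show "size ?\<E> = s" by (simp add: s)
    have "sum_mset ?\<E> = replicate_mset q (1/3) + replicate_mset q (2/3) + replicate_mset (q * (2 * n' + 1) + p * k) (1/2)"
      unfolding sum_mset.union E12 E3 sum_mset_replicate_replicate by (simp add: replicate_mset_plus)
    then show "sum_mset ?\<E> = ?Y + image_mset (\<lambda>x. 1 - x) ?Y"
      unfolding N(1) by (simp add: mult_2 replicate_mset_plus)
    show "size ?Y + s = m" using N(2) by simp
    show "1 / 3 \<le> x" if "E \<in># ?\<E>" "x \<in># E" for E x
      using that ge E3 by (auto split: if_splits)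
    show "real m / real s - 1 - U \<le> sum_mset E \<and> sum_mset E \<le> real m / real s - 1 + A"
      if "E \<in># ?\<E>" for E
      using that sumE b1 b2 AU unfolding r by (auto split: if_splits)
  qed (use assms AU in auto)
  show ?thesis
  \<comment> \<open>There are w students with n + 1 pieces and s - w with n. The smaller group is
    matched completely, so the p remaining students all have the same number of pieces.\<close>
  proof (cases "2 * w \<le> s")
    case True
    define p where "p = s - 2 * w"
    have s: "s = 2 * w + p" using True by (simp add: p_def)
    have c4: "c \<le> 1 / 4"
      using True spos by (simp add: c_def field_simps)
    have "2 * m = (n' + 3) * (2 * w + p) + w" using mw(1) n' s by simp
    then have ev: "w * (2 * n' + 1) + p * (n' + 1) = 2 * (m - s - w)" "w + (m - s - w) + s = m"
      using s by (auto simp: algebra_simps)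
    \<comment> \<open>U = c makes the lower bound sharp for the remaining students, and A = 1/3 - c
      the upper bound sharp for \<open>E2\<close>; A \<ge> 0 comes from c \<le> 1/4.\<close>
    show ?thesis
      by (rule build[OF refl s ev, where A = "1/3 - c" and U = c])
        (use c0 c4 in \<open>auto simp: n' field_simps\<close>)
  next
    case False
    define q where "q = s - w"
    define p where "p = 2 * w - s"
    have s: "s = 2 * q + p" and w: "w = q + p" using False mw(2) by (simp_all add: q_def p_def)
    have c4: "1 / 4 \<le> c" "c \<le> 1 / 2"
      using False mw(2) spos by (simp_all add: c_def field_simps)
    have "2 * m = (n' + 3) * (2 * q + p) + (q + p)" using mw(1) n' s w by simp
    then have ev: "q * (2 * n' + 1) + p * (n' + 2) = 2 * (m - s - q)" "q + (m - s - q) + s = m"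
      using s by (auto simp: algebra_simps)
    \<comment> \<open>U = c - 1/6 makes the lower bound sharp for \<open>E1\<close>, and A = 1/2 - c
      the upper bound sharp for the remaining students; U \<ge> 0 comes from c \<ge> 1/4.\<close>
    show ?thesis
      by (rule build[OF refl s ev, where A = "1/2 - c" and U = "c - 1/6"])
        (use c4 in \<open>auto simp: n' field_simps\<close>)
  qed
qed

section \<open>Normal form and attainment of the supremum\<close>

lemma halved_mono: "halved m s t \<D> \<Longrightarrow> t' \<le> t \<Longrightarrow> halved m s t' \<D>"
  by (force simp: halved_def)

text \<open>Pieces above 1/3 leave at most two per muffin. An uncut muffin is replaced by two halves
  for the same student, which t \<le> 1/2 permits.\<close>

lemma halved_of_muffin_proc:
  assumes proc: "muffin_proc m s k mu st sz" and big: "\<And>p. p < k \<Longrightarrow> t \<le> sz p" and t: "1 / 3 < t" "t \<le> 1 / 2"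
  shows "\<exists>\<D>. halved m s t \<D>"
proof -
  define w where "w p = (if sz p = 1 then {#1/2, 1/2#} else {#sz p#})" for p
  define D where "D j = (\<Sum>p\<in>{p. p < k \<and> st p = j}. w p)" for j
  have "\<exists>x. (\<Sum>p\<in>{p. p < k \<and> mu p = i}. w p) = {#x, 1 - x#}" if i: "i < m" for i
  proof -
    let ?F = "{p. p < k \<and> mu p = i}"
    have one: "sum sz ?F = 1" using proc i by (simp add: muffin_proc_def)
    have "real (card ?F) * t \<le> sum sz ?F" by (rule sum_bounded_below) (use big in auto)
    moreover have "3 * t \<le> real (card ?F) * t" if "card ?F \<ge> 3"
      using that t(1) by (intro mult_right_mono) auto
    ultimately have "card ?F < 3" using one t(1) by linarith
    moreover have "card ?F \<noteq> 0"
    proof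
      assume "card ?F = 0"
      then have "?F = {}" by simp
      then show False using one by (metis sum.empty zero_neq_one)
    qed
    ultimately consider "card ?F = 1" | "card ?F = 2" by linarith
    then show ?thesis
    proof cases
      case 1
      then obtain p where p: "?F = {p}" by (auto simp: card_1_singleton_iff)
      then have "sz p = 1" using one by simp
      then show ?thesis unfolding p by (intro exI[of _ "1/2"]) (simp add: w_def)
    next
      case 2
      then obtain p q where pq: "?F = {p, q}" "p \<noteq> q" by (auto simp: card_2_iff)
      then have "p < k" "q < k" by auto
      then have "sz p > 0" "sz q > 0" using big t(1) by (force intro: less_le_trans[of 0 t])+
      moreover have "sz q = 1 - sz p" using one pq by simp
      ultimately show ?thesis using pq by (intro exI[of _ "sz p"]) (auto simp: w_def)
    qed
  qed
  then obtain x where x: "\<And>i. i < m \<Longrightarrow> (\<Sum>p\<in>{p. p < k \<and> mu p = i}. w p) = {#x i, 1 - x i#}" by metis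
  have group: "(\<Sum>i<n. \<Sum>p\<in>{p. p < k \<and> c p = i}. w p) = (\<Sum>p<k. w p)" if "\<And>p. p < k \<Longrightarrow> c p < n" for c and n :: nat
    using sum.group[of "{..<k}" "{..<n}" c w] that by auto
  define X where "X = (\<Sum>i<m. {#x i#})"
  have "sum_mset (image_mset D (mset_set {..<s})) = (\<Sum>p<k. w p)"
    unfolding D_def sum_unfold_sum_mset[symmetric] by (rule group) (use proc in \<open>simp add: muffin_proc_def\<close>)
  also have "\<dots> = (\<Sum>i<m. {#x i, 1 - x i#})"
    using group[of mu m] proc by (simp add: x muffin_proc_def)
  also have "\<dots> = X + image_mset (\<lambda>x. 1 - x) X"
    by (simp add: X_def image_mset_sum add_mset_commute flip: sum.distrib)
  finally have sumD: "sum_mset (image_mset D (mset_set {..<s})) = X + image_mset (\<lambda>x. 1 - x) X" .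
  have "sum_mset (D j) = real m / real s \<and> (\<forall>x\<in>#D j. t \<le> x)" if j: "j < s" for j
  proof -
    have "sum_mset (D j) = (\<Sum>p\<in>{p. p < k \<and> st p = j}. sum_mset (w p))"
      unfolding D_def by (rule sum_mset_sum) simp
    also have "\<dots> = (\<Sum>p\<in>{p. p < k \<and> st p = j}. sz p)" by (rule sum.cong) (auto simp: w_def)
    finally show ?thesis using proc j big t(2)
      by (auto simp: muffin_proc_def D_def set_mset_sum w_def split: if_splits)
  qed
  then have "halved m s t (image_mset D (mset_set {..<s}))"
    using sumD unfolding halved_def by (auto intro!: exI[of _ X] simp: X_def)
  then show ?thesis by blast
qed

text \<open>If all pieces exceed 1/2, no muffin is cut, so each share m / s is a whole number of
  muffins.\<close>

lemma smallest_piece_le_half: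
  assumes proc: "muffin_proc m s k mu st sz" and "\<not> s dvd m" "m \<ge> 1" "s \<ge> 1"
  shows "smallest_piece k sz \<le> 1 / 2"
proof (rule ccontr)
  assume neg: "\<not> ?thesis"
  have big: "sz p > 1 / 2" if "p < k" for p using smallest_piece_le[OF that, of sz] neg by simp
  have one: "sz p = 1" if p: "p < k" for p
  proof -
    let ?F = "{q. q < k \<and> mu q = mu p}"
    have sum1: "sum sz ?F = 1" using proc p by (simp add: muffin_proc_def)
    have "?F = {p}"
    proof (rule ccontr)
      assume "?F \<noteq> {p}"
      then obtain q where q: "q \<in> ?F" "q \<noteq> p" using p by auto
      have "sum sz {p, q} \<le> sum sz ?F"
        by (rule sum_mono2) (use p q proc in \<open>auto simp: muffin_proc_def less_imp_le\<close>)
      then show False using sum1 big[OF p] big[of q] q by simp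
    qed
    then show ?thesis using sum1 by simp
  qed
  have "(\<Sum>p\<in>{p. p < k \<and> st p = 0}. sz p) = real m / real s" using proc assms(4) by (simp add: muffin_proc_def)
  moreover have "(\<Sum>p\<in>{p. p < k \<and> st p = 0}. sz p) = real (card {p. p < k \<and> st p = 0})"
    by (simp add: one)
  ultimately have "real m = real (s * card {p. p < k \<and> st p = 0})" using assms(4) by (simp add: field_simps)
  then have "m = s * card {p. p < k \<and> st p = 0}" by (simp only: of_nat_eq_iff)
  then show False using assms(2) by (metis dvd_triv_left)
qed

text \<open>Compactness: for each t the admissible size vectors form a closed set, a finite union
  over assignments. These sets shrink as t grows and are nonempty below T, so a single vector lies
  in all of them.\<close>

lemma halved_attained:
  assumes "T > 0" "\<And>t. 0 < t \<Longrightarrow> t < T \<Longrightarrow> \<exists>\<D>. halved m s t \<D>"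
  shows "\<exists>\<D>. halved m s T \<D>"
proof -
  \<comment> \<open>Size vectors are functions on all of \<open>nat\<close>, so the cube is an
    infinite product, compact by Tychonoff's theorem.\<close>
  define Q :: "(nat \<Rightarrow> real) set" where "Q = Pi\<^sub>E UNIV (\<lambda>_. {0..1})"
  define St where "St = Pi\<^sub>E {..<2*m} (\<lambda>_. {..<s})"
  define P where "P t st = {sz :: nat \<Rightarrow> real. (\<forall>i\<in>{..<m}. sz (2*i) + sz (2*i+1) = 1) \<and>
    (\<forall>j\<in>{..<s}. (\<Sum>p\<in>{p. p < 2*m \<and> st p = j}. sz p) = real m / real s) \<and> (\<forall>p\<in>{..<2*m}. t \<le> sz p)}" for t st
  have coord: "continuous_on UNIV (\<lambda>sz :: nat \<Rightarrow> real. sz p)" for p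
    by (rule continuous_on_product_coordinates)
  have closedP: "closed (P t st)" for t st
    unfolding P_def Collect_conj_eq Collect_ball_eq
    by (intro closed_Int closed_INT ballI closed_Collect_eq closed_Collect_le continuous_intros coord)
  have "finite St" by (simp add: St_def finite_PiE)
  then have closedC: "closed (\<Union>st\<in>St. P t st)" for t using closedP by (intro closed_UN) auto
  have "compact Q"
    using compactin_PiE[of "\<lambda>_::nat. euclidean :: real topology" UNIV "\<lambda>_. {0..1}"]
    by (simp add: Q_def euclidean_product_topology)
  have mono: "P t st \<subseteq> P t' st" if "t' \<le> t" for t t' st
    using that by (force simp: P_def)
  have nonempty: "Q \<inter> (\<Union>st\<in>St. P t st) \<noteq> {}" if t: "0 < t" "t < T" for t
  proof -
    obtain \<D> where "halved m s t \<D>" using assms(2)[OF t] by blast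
    then obtain st sz where proc: "muffin_proc m s (2*m) (\<lambda>p. p div 2) st sz" and ge: "\<forall>p<2*m. t \<le> sz p"
      and "\<forall>j<s. \<exists>D\<in>#\<D>. card {p. p < 2 * m \<and> st p = j} = size D"
      using t(1) by (rule proc_of_halved) (rule that)
    \<comment> \<open>The default 0 beyond the pieces puts \<open>sz'\<close> into the cube.\<close>
    define sz' where "sz' p = (if p < 2*m then sz p else 0)" for p
    define st' where "st' = restrict st {..<2*m}"
    have "sz' \<in> Q"
      unfolding Q_def
    proof (intro PiE_I)
      fix p
      show "sz' p \<in> {0..1}"
        using piece_le_1[OF proc, of p] spec[OF ge, of p] t(1) by (auto simp: sz'_def)
    qed simp
    moreover have "st' \<in> St" using proc by (auto simp: St_def st'_def muffin_proc_def)
    moreover have "sz' \<in> P t st'"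
    proof -
      have "sz' (2*i) + sz' (2*i+1) = 1" if "i < m" for i
      proof -
        have "(\<Sum>p\<in>{p. p < 2*m \<and> p div 2 = i}. sz p) = 1" using proc that by (simp add: muffin_proc_def)
        then show ?thesis using that unfolding pair_fibre by (simp add: sz'_def)
      qed
      moreover have "(\<Sum>p\<in>{p. p < 2*m \<and> st' p = j}. sz' p) = real m / real s" if "j < s" for j
      proof -
        have "{p. p < 2*m \<and> st' p = j} = {p. p < 2*m \<and> st p = j}" by (auto simp: st'_def)
        then have "(\<Sum>p\<in>{p. p < 2*m \<and> st' p = j}. sz' p) = (\<Sum>p\<in>{p. p < 2*m \<and> st p = j}. sz p)"
          by (simp add: sz'_def)
        then show ?thesis using proc that by (simp add: muffin_proc_def)
      qed
      ultimately show ?thesis using ge by (simp add: P_def sz'_def)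
    qed
    ultimately show ?thesis by blast
  qed
  have "Q \<inter> (\<Inter>t\<in>{0<..<T}. \<Union>st\<in>St. P t st) \<noteq> {}"
  proof (rule compact_imp_fip_image[OF \<open>compact Q\<close>])
    fix I assume I: "finite I" "I \<subseteq> {0<..<T}"
    \<comment> \<open>Inserting T / 2 keeps the maximum defined, with a value strictly between 0 and
      T, when \<open>I\<close> is empty.\<close>
    define t where "t = Max (insert (T / 2) I)"
    have "t \<in> insert (T / 2) I" unfolding t_def using I(1) by (intro Max_in) auto
    then have "0 < t" "t < T" using I(2) assms(1) by auto
    then obtain sz st where sz: "sz \<in> Q" "st \<in> St" "sz \<in> P t st" using nonempty by blast
    have "t' \<le> t" if "t' \<in> I" for t' unfolding t_def using I(1) that by (intro Max_ge) auto
    then have "sz \<in> (\<Union>st\<in>St. P t' st)" if "t' \<in> I" for t' using mono sz(2,3) that by blast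
    then show "Q \<inter> (\<Inter>t\<in>I. \<Union>st\<in>St. P t st) \<noteq> {}" using sz(1) by blast
  qed (rule closedC)
  then obtain sz where sz0: "sz \<in> (\<Inter>t\<in>{0<..<T}. \<Union>st\<in>St. P t st)" by blast
  have sz: "\<exists>st\<in>St. sz \<in> P t st" if "0 < t" "t < T" for t using sz0 that by simp
  have ge: "T \<le> sz p" if "p < 2*m" for p
  proof (rule dense_le_bounded[OF assms(1)])
    fix t assume t: "0 < t" "t < T"
    then show "t \<le> sz p" using sz[OF t] that by (auto simp: P_def)
  qed
  \<comment> \<open>The equations in \<open>P\<close> do not depend on t, so an assignment found at
    T / 2 serves; the lower bound T is already known.\<close>
  obtain st where st: "st \<in> St" "sz \<in> P (T / 2) st" using sz[of "T / 2"] assms(1) by auto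
  have "muffin_proc m s (2*m) (\<lambda>p. p div 2) st sz"
    unfolding muffin_proc_def
  proof (intro conjI allI impI)
    fix p assume p: "p < 2*m"
    then show "p div 2 < m" "st p < s" "0 < sz p" using st(1) ge[OF p] assms(1) by (auto simp: St_def)
  next
    fix i assume "i < m"
    then show "(\<Sum>p\<in>{p. p < 2*m \<and> p div 2 = i}. sz p) = 1"
      unfolding pair_fibre using st(2) by (simp add: P_def)
  next
    fix j assume "j < s"
    then show "(\<Sum>p\<in>{p. p < 2*m \<and> st p = j}. sz p) = real m / real s" using st(2) by (simp add: P_def)
  qed
  then show ?thesis using ge by (intro halved_of_proc) auto
qed

text \<open>Up to 1/3 the cycle construction applies. Above it, a procedure with smallest piece over
  t is normalised to two pieces per muffin, where t \<le> 1/2 because \<open>s\<close> does not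
  divide \<open>m\<close>. Compactness then reaches the supremum itself.\<close>

lemma halved_muffin_f:
  assumes "s \<ge> 1" "3 * s \<le> 2 * m" "\<not> s dvd m"
  shows "muffin_f m s \<ge> 1 / 3" "\<exists>\<D>. halved m s (muffin_f m s) \<D>"
proof -
  have m1: "m \<ge> 1" using assms by simp
  obtain \<D> where third: "halved m s (1 / 3) \<D>" using halved_third[OF assms(1,2)] by blast
  then show f: "muffin_f m s \<ge> 1 / 3" using halved_le_muffin_f[OF third _ m1] by simp
  obtain st sz where pr: "muffin_proc m s (2*m) (\<lambda>p. p div 2) st sz"
    by (rule proc_of_halved[OF third]) auto
  show "\<exists>\<D>. halved m s (muffin_f m s) \<D>"
  proof (rule halved_attained)
    fix t assume t: "0 < t" "t < muffin_f m s"
    show "\<exists>\<D>. halved m s t \<D>"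
    proof (cases "t \<le> 1 / 3")
      case True
      then show ?thesis using third halved_mono by blast
    next
      case False
      obtain v where "v \<in> {smallest_piece k sz | k mu st sz. muffin_proc m s k mu st sz}" "t < v"
        using t(2) unfolding muffin_f_def by (rule less_cSupE) (use pr in blast)
      then obtain k mu st sz where p: "muffin_proc m s k mu st sz" "t < smallest_piece k sz" by blast
      have "t \<le> 1 / 2" using smallest_piece_le_half[OF p(1) assms(3) m1 assms(1)] p(2) by simp
      moreover have "t \<le> sz p" if "p < k" for p using smallest_piece_le[OF that, of sz] p(2) by simp
      ultimately show ?thesis using False by (intro halved_of_muffin_proc[OF p(1)]) auto
    qed
  qed (use f in simp)
qed

section \<open>The optimal value in all cases\<close>

theorem theorem14:
  fixes d b a :: nat
  assumes "d \<ge> 1" and "b \<ge> 1" and "a < 3 * d"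
  shows "fc_optimal_value (3*d*b + a) (3*d*b + a - d)
           ((real d * real b + muffin_X a d) / (3 * real d * real b + real a - real d))"
proof -
  define m where "m = 3*d*b + a"
  define s where "s = 3*d*b + a - d"
  define v where "v = (real d * real b + muffin_X a d) / real s"
  have db1: "d * b \<ge> d * 1" using assms(2) by (intro mult_left_mono) auto
  moreover have "3*d*b = 3 * (d * b)" by simp
  ultimately have ms: "m = s + d" and s2: "s \<ge> 2 * d" unfolding m_def s_def by linarith+
  have rs: "3 * real d * real b + real a - real d = real s"
    using arg_cong[OF ms, of real] by (simp add: m_def)
  have spos: "real s > 0" using s2 assms(1) by simp
  have db: "real d * real b \<ge> real d"
    using db1 by (metis mult.right_neutral of_nat_le_iff of_nat_mult)
  have "0 < (real a + real d) / 2" using assms(1) by simp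
  also have "\<dots> = real d + (real a - real d) / 2" by (simp add: field_simps)
  also have "\<dots> \<le> real d * real b + (real a - real d) / 2" using db by (rule add_right_mono)
  finally have pos: "real d * real b + (real a - real d) / 2 > 0" .
  \<comment> \<open>The cases differ only in three facts: a configuration attaining X, positivity of
    the resulting piece size, and the matching upper bound.\<close>
  have "(\<exists>\<D> X. cubic_conf a d (muffin_X a d) \<D> X \<and> (\<forall>D\<in>#\<D>. size D = 3) \<and> size \<D> = 2 * d) \<and>
    real d * real b + muffin_X a d > 0 \<and>
    (\<forall>k mu st sz. fc_proc m s k mu st sz \<longrightarrow> real s * smallest_piece k sz - real d * real b \<le> muffin_X a d)"
  proof -
    consider "a = 0" | "1 \<le> a" "a \<le> d" | "d < a" "(a - d) dvd 2 * d" | "d < a" "\<not> (a - d) dvd 2 * d"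
      by linarith
    then show ?thesis
    proof cases
      case 1
      have X: "muffin_X a d = 0" using 1 by (simp add: muffin_X_def)
      have "real s * smallest_piece k sz - real d * real b \<le> 0" if "fc_proc m s k mu st sz" for k mu st sz
      proof -
        have "smallest_piece k sz \<le> real m / (3 * real s)"
          using fc_proc_smallest_le_third[of s d k mu st sz] that ms assms(1) spos by simp
        then show ?thesis using spos 1 by (simp add: m_def field_simps)
      qed
      then show ?thesis unfolding X using cubic_conf_zero[of d] 1 db assms(1) by auto
    next
      case 2
      have X: "muffin_X a d = (real a - real d) / 2" using 2 by (simp add: muffin_X_def)
      show ?thesis unfolding X m_def s_def
        using cubic_conf_low[OF 2] fc_proc_smallest_le_half[of d b a] assms 2 pos by auto
    next
      case 3
      have X: "muffin_X a d = (real a - real d) / 2" using 3 by (simp add: muffin_X_def)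
      \<comment> \<open>With this divisibility, handing out halves only solves (a, a - d) with
        smallest piece 1/2, which scales to (a - d) / 2.\<close>
      have "a - d dvd 2 * a"
      proof -
        have "2 * a = 2 * (a - d) + 2 * d" using 3(1) by simp
        then show ?thesis using 3(2) by simp
      qed
      moreover have "a - d \<ge> 1" using 3(1) by simp
      ultimately obtain \<D> where "halved a (a - d) (1 / 2) \<D>" using halved_half by blast
      from cubic_conf_of_halved[OF this _ 3(1) assms(3)] show ?thesis unfolding X m_def s_def
        using fc_proc_smallest_le_half[of d b a] assms 3(1) pos by auto
    next
      case 4
      have X: "muffin_X a d = (real a - real d) * muffin_f a (a - d)" using 4 by (simp add: muffin_X_def)
      have "\<not> (a - d) dvd a"
      proof
        assume "a - d dvd a"
        then have "a - d dvd a - (a - d)" using dvd_refl by (rule dvd_diff_nat)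
        then show False using 4 by simp
      qed
      \<comment> \<open>The requirement 3 * (a - d) \<le> 2 * a amounts to a \<le> 3 * d.\<close>
      then have f: "muffin_f a (a - d) \<ge> 1 / 3" and "\<exists>\<D>. halved a (a - d) (muffin_f a (a - d)) \<D>"
        using halved_muffin_f[of "a - d" a] 4(1) assms(3) by auto
      then obtain \<D> where "halved a (a - d) (muffin_f a (a - d)) \<D>" by blast
      from cubic_conf_of_halved[OF this f 4(1) assms(3)]
      have "\<exists>\<D> X. cubic_conf a d (muffin_X a d) \<D> X \<and> (\<forall>D\<in>#\<D>. size D = 3) \<and> size \<D> = 2 * d"
        unfolding X .
      moreover have "muffin_X a d \<ge> 0" unfolding X using 4(1) f by (intro mult_nonneg_nonneg) auto
      then have "real d * real b + muffin_X a d > 0" using db assms(1) by linarith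
      moreover have "real s * smallest_piece k sz - real d * real b \<le> muffin_X a d"
        if "fc_proc m s k mu st sz" for k mu st sz
        using fc_proc_smallest_le_muffin_f[of d b a k mu st sz] that assms 4(1) f unfolding X m_def s_def by blast
      ultimately show ?thesis by blast
    qed
  qed
  then obtain \<D> X where conf: "cubic_conf a d (muffin_X a d) \<D> X" "\<forall>D\<in>#\<D>. size D = 3" "size \<D> = 2 * d"
    and pos: "real d * real b + muffin_X a d > 0"
    and upper: "\<And>k mu st sz. fc_proc m s k mu st sz \<Longrightarrow> real s * smallest_piece k sz - real d * real b \<le> muffin_X a d"
    by blast
  have le: "smallest_piece k sz \<le> v" if "fc_proc m s k mu st sz" for k mu st sz
    using upper[OF that] spos by (simp add: v_def field_simps)
  obtain k mu st sz where fc: "fc_proc m s k mu st sz" "\<forall>p<k. v \<le> sz p"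
    using fc_proc_of_cubic_conf[OF conf(1) _ conf(3) assms(1,2) pos] conf(2) unfolding v_def m_def s_def by blast
  have "k \<ge> 1" using fc(1) muffin_proc_pos[of m s k mu st sz] ms assms(1) by (simp add: fc_proc_def)
  then have "smallest_piece k sz = v" using le[OF fc(1)] smallest_piece_ge_iff[of k v sz] fc(2) by simp
  then have "fc_optimal_value m s v" unfolding fc_optimal_value_def using fc(1) le by blast
  then show ?thesis unfolding v_def m_def s_def rs[unfolded s_def] .
qed

end
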